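(* For every real $t$, \[ Z(t)=2\,\Re\bigl\{e^{i\vartheta(t)}U(t)\bigr\}. \]
   Context: Let $\Omega$ be the complex plane with the two cuts $\{iy: y\ge \tfrac12\}$ and $\{iy: y\le -\tfrac12\}$ removed. $\vartheta$ is the Riemann–Siegel theta function: the holomorphic function on $\Omega$ with $\vartheta(0)=0$ and \[ e^{i\vartheta(t)}=\pi^{-it/2}\sqrt{\frac{\Gamma(\frac14+\frac{it}{2})}{\Gamma(\frac14-\frac{it}{2})}}, \] which for real $t$ equals $\pi^{-it/2}\Gamma(\frac14+\frac{it}2)/|\Gamma(\frac14+\frac{it}2)|$. The function $Z(t)=e^{i\vartheta(t)}\zeta(\frac12+it)$ (real for real $t$), where $\zeta$ is the Riemann zeta function. For real $t$ define \[ U(t)=\frac{1}{2\pi i}\int_{-i\sigma-\infty}^{-i\sigma+\infty} e^{i\vartheta(t+x)-i\vartheta(t)}\,\zeta\bigl(\tfrac12+i(t+x)\bigr)\,\frac{\pi}{2\sinh\frac{\pi x}{2}}\,dx, \] with $0<\sigma<\frac12$ (the integration is along the horizontal line $\Im x=-\sigma$; the value is independent of $\sigma\in(0,\frac12)$). *)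

theory Defs
  imports "HOL-Analysis.Analysis"
begin

text \<open>Riemann zeta function: the holomorphic continuation to the plane minus 1 of the
  Dirichlet series; the (irrelevant) value at the pole 1 is fixed to 0 for uniqueness.\<close>
definition riemann_zeta :: "complex \<Rightarrow> complex" where
  "riemann_zeta = (THE f. f holomorphic_on (- {1}) \<and>
      (\<forall>s. 1 < Re s \<longrightarrow> f s = (\<Sum>n. 1 / (of_nat (Suc n)) powr s)) \<and> f 1 = 0)"

definition Omega :: "complex set" where
  "Omega = - {z. Re z = 0 \<and> \<bar>Im z\<bar> \<ge> 1/2}"

text \<open>Riemann--Siegel theta: holomorphic on Omega, theta 0 = 0, and
  exp(i theta t) = pi^(-it/2) times a square root of Gamma(1/4+it/2)/Gamma(1/4-it/2),
  i.e. exp(2 i theta t) = pi^(-it) Gamma(1/4+it/2)/Gamma(1/4-it/2).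
  Outside Omega the value is fixed to 0 (only for uniqueness).\<close>
definition RS_theta :: "complex \<Rightarrow> complex" where
  "RS_theta = (THE f. f holomorphic_on Omega \<and> f 0 = 0 \<and>
      (\<forall>t\<in>Omega. exp (2 * \<i> * f t) =
          (complex_of_real pi) powr (- \<i> * t) * Gamma (1/4 + \<i> * t / 2) / Gamma (1/4 - \<i> * t / 2)) \<and>
      (\<forall>t. t \<notin> Omega \<longrightarrow> f t = 0))"

definition Z_fun :: "real \<Rightarrow> complex" where
  "Z_fun t = exp (\<i> * RS_theta (of_real t)) * riemann_zeta (1/2 + \<i> * of_real t)"

definition U_fun :: "real \<Rightarrow> real \<Rightarrow> complex" where
  "U_fun \<sigma> t = 1 / (2 * of_real pi * \<i>) *
     (LINT u|lborel. (let x = complex_of_real u - \<i> * of_real \<sigma> in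
        exp (\<i> * RS_theta (of_real t + x) - \<i> * RS_theta (of_real t)) *
        riemann_zeta (1/2 + \<i> * (of_real t + x)) *
        (of_real pi / (2 * sinh (of_real pi * x / 2)))))"

end

theory Submission
  imports Defs "HOL-Complex_Analysis.Complex_Analysis" "HOL-Real_Asymp.Real_Asymp"
begin

text \<open>
  Write \<open>Z(z) = exp (i \<theta>(z)) \<zeta>(1/2 + i z)\<close>. The integrand of \<open>exp (i \<theta>(t)) U(t)\<close> is
  \<open>F(x) = Z(t + x) \<pi> / (2 sinh (\<pi> x / 2))\<close>, whose only pole in the strip \<open>|Im x| < 1/2\<close> is a simple
  pole at 0 with residue \<open>Z(t)\<close>. Moving the line of integration from \<open>Im x = -\<sigma>\<close> to \<open>Im x = \<sigma>\<close>
  therefore picks up \<open>Z(t)\<close>. By the functional equation \<open>cnj (Z (cnj z)) = Z z\<close>, so the integrals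
  over the two lines are conjugate to each other and their difference is twice a real part. The functional
  equation also gives \<open>Z(z)\<^sup>2 = \<zeta>(1/2 + i z) \<zeta>(1/2 - i z)\<close>, which bounds \<open>Z\<close> polynomially
  in the strip without Stirling's formula.

  The zeta function is continued to \<open>Re s > -1\<close> by the trapezoidal rule for \<open>\<integral> u\<^sup>-\<^sup>s du\<close>. For real
  \<open>-1 < s < 0\<close>, writing the error terms of that rule as Laplace integrals gives
  \<open>\<Gamma>(s) \<zeta>(s) = \<integral> x powr (s - 1) (1 / (exp x - 1) + 1/2 - 1/x) dx\<close> over \<open>x > 0\<close>. Expanding the bracket
  into partial fractions \<open>2 x / (x\<^sup>2 + (2 \<pi> n)\<^sup>2)\<close> and integrating termwise, where everything is
  positive, yields the functional equation on that interval; the identity theorem does the rest.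
\<close>

section \<open>Integrals and the partial fractions of coth\<close>

text \<open>The logarithmic derivative of the reflection formula for Gamma gives
  \<open>Digamma (1 - z) - Digamma z\<close> as pi cot(pi z), and the series for
  \<open>Digamma\<close> turns this into partial fractions. At z = i x / (2 pi) the cotangent
  becomes hyperbolic, and the limit is coth(x/2) / 2 - 1/x.\<close>

lemma coth_partial_fractions:
  fixes x :: real
  assumes "x > 0"
  shows "(\<lambda>n. 2 * x / (x\<^sup>2 + (2 * pi * real (Suc n))\<^sup>2)) sums (1 / (exp x - 1) + 1/2 - 1/x)"
proof -
  define a where "a = x / (2 * pi)"
  define z where "z = \<i> * complex_of_real a"
  have a: "a > 0" using assms by (simp add: a_def)
  have zi: "z \<notin> \<int>" "1 - z \<notin> \<int>" "z + 1 \<notin> \<int>"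
    using a by (auto elim!: Ints_cases simp: z_def complex_eq_iff)
  have z0: "z \<noteq> 0" using a by (simp add: z_def)
  have nz: "z \<notin> \<int>\<^sub>\<le>\<^sub>0" "1 - z \<notin> \<int>\<^sub>\<le>\<^sub>0"
    using zi nonpos_Ints_subset_Ints by blast+
  have sinh: "sin (of_real pi * w) \<noteq> 0" if "w \<notin> \<int>" for w :: complex
    using that by (auto simp: sin_eq_0)
  have der1: "((\<lambda>w. Gamma w * Gamma (1 - w)) has_field_derivative
      Gamma z * Digamma z * Gamma (1 - z) - Gamma z * (Gamma (1 - z) * Digamma (1 - z))) (at z)"
    using nz by (auto intro!: derivative_eq_intros)
  have der2: "((\<lambda>w. of_real pi / sin (of_real pi * w)) has_field_derivative
      - (of_real pi * (of_real pi * cos (of_real pi * z))) / (sin (of_real pi * z))\<^sup>2) (at z)"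
    using sinh[OF zi(1)] by (auto intro!: derivative_eq_intros simp: power2_eq_square field_simps)
  have "Gamma z * Digamma z * Gamma (1 - z) - Gamma z * (Gamma (1 - z) * Digamma (1 - z)) =
     - (of_real pi * (of_real pi * cos (of_real pi * z))) / (sin (of_real pi * z))\<^sup>2"
    using der1 der2 unfolding Gamma_reflection_complex by (rule DERIV_unique)
  hence "(Gamma z * Gamma (1 - z)) * (Digamma z - Digamma (1 - z)) =
     - (of_real pi * (of_real pi * cos (of_real pi * z))) / (sin (of_real pi * z))\<^sup>2"
    by (simp add: algebra_simps)
  moreover have "Gamma z * Gamma (1 - z) \<noteq> 0"
    unfolding Gamma_reflection_complex using sinh[OF zi(1)] by simp
  ultimately have "Digamma z - Digamma (1 - z) =
     (- (of_real pi * (of_real pi * cos (of_real pi * z))) / (sin (of_real pi * z))\<^sup>2) / (Gamma z * Gamma (1 - z))"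
    by (metis nonzero_mult_div_cancel_left)
  also have "\<dots> = - (of_real pi * cos (of_real pi * z) / sin (of_real pi * z))"
    unfolding Gamma_reflection_complex using sinh[OF zi(1)] by (simp add: power2_eq_square)
  finally have "Digamma (1 - z) - Digamma z = of_real pi * cos (of_real pi * z) / sin (of_real pi * z)"
    by (simp add: algebra_simps)
  \<comment> \<open>Passing to z + 1 splits off the pole at 0, so that the two series pair the poles
    at m and -m with m = n + 1.\<close>
  moreover have "Digamma (z + 1) = Digamma z + 1 / z" using z0 by (rule Digamma_plus1)
  ultimately have D: "Digamma (1 - z) - Digamma (z + 1) =
      of_real pi * cos (of_real pi * z) / sin (of_real pi * z) - 1 / z" by (simp add: algebra_simps)
  have S: "(\<lambda>n. inverse (of_nat (Suc n)) - inverse (w + of_nat n)) sums (Digamma w + euler_mascheroni)"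
    if "w \<noteq> 0" for w :: complex
    using summable_sums[OF summable_Digamma[OF that]] by (simp add: Digamma_def)
  have "1 - z \<noteq> 0" "z + 1 \<noteq> 0" using zi by (metis Ints_0)+
  from sums_diff[OF S[OF this(1)] S[OF this(2)]]
  have "(\<lambda>n. inverse (z + 1 + of_nat n) - inverse (1 - z + of_nat n)) sums
      (of_real pi * cos (of_real pi * z) / sin (of_real pi * z) - 1 / z)"
    by (simp add: D[symmetric])
  \<comment> \<open>For purely imaginary z the terms are imaginary; the factor i / (2 pi) makes them
    real with the required normalization.\<close>
  hence "(\<lambda>n. \<i> / (2 * of_real pi) * (inverse (z + 1 + of_nat n) - inverse (1 - z + of_nat n))) sums
      (\<i> / (2 * of_real pi) * (of_real pi * cos (of_real pi * z) / sin (of_real pi * z) - 1 / z))"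
    by (rule sums_mult)
  also have "(\<lambda>n. \<i> / (2 * of_real pi) * (inverse (z + 1 + of_nat n) - inverse (1 - z + of_nat n)))
      = (\<lambda>n. of_real (2 * x / (x\<^sup>2 + (2 * pi * real (Suc n))\<^sup>2)))"
  proof
    fix n
    define m where "m = complex_of_real (real (Suc n))"
    have 1: "z + 1 + of_nat n = m + z" "1 - z + of_nat n = m - z" by (auto simp: m_def)
    have ne: "m + z \<noteq> 0" "m - z \<noteq> 0" using a by (auto simp: m_def z_def complex_eq_iff)
    have "(m + z) * (m - z) = of_real ((real (Suc n))\<^sup>2 + a\<^sup>2)"
      by (simp add: m_def z_def algebra_simps power2_eq_square)
    moreover have "inverse (m + z) - inverse (m - z) = - 2 * z / ((m + z) * (m - z))"
      using ne by (simp add: divide_simps)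
    ultimately have "inverse (m + z) - inverse (m - z) = - 2 * z / of_real ((real (Suc n))\<^sup>2 + a\<^sup>2)"
      by metis
    hence "\<i> / (2 * of_real pi) * (inverse (m + z) - inverse (m - z)) =
       of_real (a / pi / ((real (Suc n))\<^sup>2 + a\<^sup>2))"
      by (simp only:) (simp add: z_def)
    also have "a / pi / ((real (Suc n))\<^sup>2 + a\<^sup>2) = 2 * x / (x\<^sup>2 + (2 * pi * real (Suc n))\<^sup>2)"
    proof -
      have "(real (Suc n))\<^sup>2 + a\<^sup>2 = (x\<^sup>2 + (2 * pi * real (Suc n))\<^sup>2) / (4 * pi\<^sup>2)"
        by (simp add: a_def power2_eq_square add_divide_distrib)
      thus ?thesis by (simp add: a_def power2_eq_square)
    qed
    finally show "\<i> / (2 * of_real pi) * (inverse (z + 1 + of_nat n) - inverse (1 - z + of_nat n)) =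
       of_real (2 * x / (x\<^sup>2 + (2 * pi * real (Suc n))\<^sup>2))" unfolding 1 .
  qed
  also have "\<i> / (2 * of_real pi) * (of_real pi * cos (of_real pi * z) / sin (of_real pi * z) - 1 / z)
     = of_real (1 / (exp x - 1) + 1/2 - 1/x)"
  proof -
    have pz: "of_real pi * z = \<i> * of_real (x / 2)" by (simp add: z_def a_def)
    have e1: "exp x \<noteq> 1" using assms by simp
    have sq: "exp x = exp (x/2) * exp (x/2)" by (simp flip: exp_add)
    have c: "cos (\<i> * of_real (x/2)) = of_real ((exp (x/2) + exp (-(x/2))) / 2)"
      by (simp add: cos_exp_eq exp_of_real[symmetric] flip: mult.assoc)
    have s: "sin (\<i> * of_real (x/2)) = \<i> * of_real ((exp (x/2) - exp (-(x/2))) / 2)"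
      by (simp add: sin_exp_eq exp_of_real[symmetric] field_simps flip: mult.assoc)
    have "\<i> / (2 * of_real pi) * (of_real pi * cos (of_real pi * z) / sin (of_real pi * z) - 1 / z)
       = of_real (1/2 * ((exp (x/2) + exp (-(x/2))) / (exp (x/2) - exp (-(x/2)))) - 1/x)"
      unfolding pz c s using assms by (simp add: z_def a_def field_simps)
    also have "(exp (x/2) + exp (-(x/2))) / (exp (x/2) - exp (-(x/2))) = (exp x + 1) / (exp x - 1)"
      using e1 by (simp add: sq exp_minus divide_simps)
    also have "1/2 * ((exp x + 1) / (exp x - 1)) = 1 / (exp x - 1) + 1/2"
      using e1 by (simp add: field_simps)
    finally show ?thesis by simp
  qed
  finally show ?thesis by (simp only: sums_of_real_iff)
qed

text \<open>Two integrations by parts against the Peano kernel (u - a)(a + 1 - u)/2, which vanishes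
  at both ends. Continuity at the ends is asked only of (u - a) g(u), so that g may blow up at the
  left end; this happens for powers of u at a = 0.\<close>

lemma trapezoid_error_has_integral:
  fixes F f g h :: "real \<Rightarrow> 'a::{real_normed_field,banach}"
  assumes F: "\<And>u. a < u \<Longrightarrow> u < a + 1 \<Longrightarrow> (F has_vector_derivative f u) (at u)"
    and f: "\<And>u. a < u \<Longrightarrow> u < a + 1 \<Longrightarrow> (f has_vector_derivative g u) (at u)"
    and g: "\<And>u. a < u \<Longrightarrow> u < a + 1 \<Longrightarrow> (g has_vector_derivative h u) (at u)"
    and cont: "continuous_on {a..a+1} F" "continuous_on {a..a+1} f"
      "continuous_on {a..a+1} (\<lambda>u. (u - a) *\<^sub>R g u)"
  shows "((\<lambda>u. ((u - a) * (a + 1 - u) / 2) *\<^sub>R h u) has_integral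
           ((1/2) *\<^sub>R (f a + f (a + 1)) - (F (a + 1) - F a))) {a..a+1}"
proof -
  \<comment> \<open>Antiderivative collected from the two integrations by parts, grouped so that g
    enters only through (u - a) g(u).\<close>
  define H where "H u = ((a + 1 - u) / 2) *\<^sub>R ((u - a) *\<^sub>R g u) - ((2 * a + 1 - 2 * u) / 2) *\<^sub>R f u - F u" for u
  have "((\<lambda>u. ((u - a) * (a + 1 - u) / 2) *\<^sub>R h u) has_integral (H (a + 1) - H a)) {a..a+1}"
  proof (rule fundamental_theorem_of_calculus_interior)
    show "continuous_on {a..a + 1} H"
      unfolding H_def by (intro continuous_intros cont) auto
    fix u assume u: "u \<in> {a<..<a+1}"
    have "(H has_vector_derivative
      (((a + 1 - u) / 2) *\<^sub>R ((u - a) *\<^sub>R h u + 1 *\<^sub>R g u) + (- 1 / 2) *\<^sub>R ((u - a) *\<^sub>R g u))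
       - (((2 * a + 1 - 2 * u) / 2) *\<^sub>R g u + (- 1) *\<^sub>R f u) - f u) (at u)"
      unfolding H_def using u
      by (intro has_vector_derivative_diff has_vector_derivative_scaleR F f g)
         (auto intro!: derivative_eq_intros)
    thus "(H has_vector_derivative ((u - a) * (a + 1 - u) / 2) *\<^sub>R h u) (at u)"
      by (rule has_vector_derivative_eq_rhs) (simp add: scaleR_conv_of_real field_simps)
  qed auto
  also have "H (a + 1) - H a = (1/2) *\<^sub>R (f a + f (a + 1)) - (F (a + 1) - F a)"
    by (simp add: H_def algebra_simps)
  finally show ?thesis .
qed

section \<open>Gamma integrals over the half-line\<close>

lemma Gamma_integral_scaled:
  fixes z u :: real
  assumes "z > 0" "u > 0"
  shows "((\<lambda>x. x powr (z - 1) * exp (- u * x)) has_integral Gamma z * u powr - z) {0<..}"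
    and "(\<lambda>x. x powr (z - 1) * exp (- u * x)) absolutely_integrable_on {0<..}"
proof -
  define f where "f = (\<lambda>x::real. x powr (z - 1) * exp (- u * x))"
  have im: "(\<lambda>x. x / u) ` {0<..} = {0<..}"
  proof -
    have "y \<in> (\<lambda>x. x / u) ` {0<..}" if "y > 0" for y
      using that assms by (intro image_eqI[of _ _ "u * y"]) auto
    thus ?thesis using assms by auto
  qed
  have "((\<lambda>t. t powr (z - 1) / exp t) has_integral Gamma z) {0..}"
    using assms by (intro Gamma_integral_real)
  hence "((\<lambda>t. t powr (z - 1) / exp t) has_integral Gamma z) {0<..}"
    by (subst (asm) has_integral_spike_set_eq[where T = "{0<..}"])
       (auto intro: negligible_subset[OF negligible_sing[of 0]])
  hence "((\<lambda>t. u powr - z * (t powr (z - 1) / exp t)) has_integral u powr - z * Gamma z) {0<..}"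
    by (rule has_integral_mult_right)
  hence "((\<lambda>x. \<bar>1 / u\<bar> * f (x / u)) has_integral (u powr - z * Gamma z)) {0<..}"
  proof (rule has_integral_eq[rotated])
    fix x :: real assume x: "x \<in> {0<..}"
    have "(x / u) powr (z - 1) = x powr (z - 1) / (u powr z / u)"
      using x assms by (simp add: powr_divide powr_diff)
    thus "u powr - z * (x powr (z - 1) / exp x) = \<bar>1 / u\<bar> * f (x / u)"
      using x assms by (simp add: f_def powr_minus_divide exp_minus inverse_eq_divide)
  qed
  hence "(\<lambda>x. \<bar>1 / u\<bar> * f (x / u)) absolutely_integrable_on {0<..} \<and>
      integral {0<..} (\<lambda>x. \<bar>1 / u\<bar> * f (x / u)) = u powr - z * Gamma z"
    using assms by (auto simp: has_integral_iff f_def intro!: nonnegative_absolutely_integrable_1)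
  hence "f absolutely_integrable_on {0<..} \<and> integral {0<..} f = u powr - z * Gamma z"
    using assms
    by (subst (asm) has_absolute_integral_change_of_variables_1')
       (auto simp: im inj_on_def intro!: derivative_eq_intros)
  thus "f absolutely_integrable_on {0<..}" "(f has_integral Gamma z * u powr - z) {0<..}"
    by (auto simp: has_integral_iff mult.commute dest: set_lebesgue_integral_eq_integral(1))
qed

text \<open>Substitute y = x^2 in \<open>Gamma_integral_scaled\<close> with exponent (s +
  1)/2.\<close>

lemma Gamma_integral_gaussian:
  fixes s v :: real
  assumes "s > -1" "v > 0"
  shows "((\<lambda>x. 2 * x powr s * exp (- v * x\<^sup>2)) has_integral Gamma ((s+1)/2) * v powr (- ((s+1)/2))) {0<..}"
proof -
  define f where "f = (\<lambda>y::real. y powr ((s+1)/2 - 1) * exp (- v * y))"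
  have im: "(\<lambda>x::real. x\<^sup>2) ` {0<..} = {0<..}"
  proof -
    have "y \<in> (\<lambda>x. x\<^sup>2) ` {0<..}" if "y > 0" for y :: real
      using that by (intro image_eqI[of _ _ "sqrt y"]) auto
    thus ?thesis by auto
  qed
  have "f absolutely_integrable_on {0<..} \<and> integral {0<..} f = Gamma ((s+1)/2) * v powr (- ((s+1)/2))"
    using Gamma_integral_scaled[of "(s+1)/2" v] assms by (auto simp: f_def has_integral_iff)
  hence "(\<lambda>x. \<bar>2 * x\<bar> * f (x\<^sup>2)) absolutely_integrable_on {0<..} \<and>
      integral {0<..} (\<lambda>x. \<bar>2 * x\<bar> * f (x\<^sup>2)) = Gamma ((s+1)/2) * v powr (- ((s+1)/2))"
    by (subst has_absolute_integral_change_of_variables_1')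
       (auto simp: im inj_on_def intro!: derivative_eq_intros)
  hence "((\<lambda>x. \<bar>2 * x\<bar> * f (x\<^sup>2)) has_integral Gamma ((s+1)/2) * v powr (- ((s+1)/2))) {0<..}"
    by (auto simp: has_integral_iff dest: set_lebesgue_integral_eq_integral(1))
  moreover have "\<bar>2 * x\<bar> * f (x\<^sup>2) = 2 * x powr s * exp (- v * x\<^sup>2)" if "x \<in> {0<..}" for x
  proof -
    have "(x\<^sup>2) powr ((s+1)/2 - 1) = x powr (s - 1)"
      using that by (simp add: powr_powr diff_divide_distrib flip: powr_numeral)
    thus ?thesis using that by (simp add: f_def powr_diff)
  qed
  ultimately show ?thesis
    by (rule has_integral_eq[rotated])
qed

text \<open>Write 1 / (x^2 + a^2) as the integral of exp(-(x^2 + a^2) v) over v > 0 and exchange by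
  Tonelli. The x-integral is then Gaussian and the v-integral is a Gamma integral; the bounds on s
  keep both Gamma arguments positive.\<close>

lemma nn_integral_powr_over_square_add:
  fixes s a :: real
  assumes s: "-1 < s" "s < 1" and a: "a > 0"
  shows "(\<integral>\<^sup>+x\<in>{0<..}. ennreal (2 * x powr s / (x\<^sup>2 + a\<^sup>2)) \<partial>lborel) =
      ennreal (Gamma ((1 + s) / 2) * Gamma ((1 - s) / 2) * a powr (s - 1))"
proof -
  have exp_int: "(\<integral>\<^sup>+v\<in>{0<..}. ennreal (exp (- b * v)) \<partial>lborel) = ennreal (1 / b)" if "b > 0" for b :: real
  proof -
    have "((\<lambda>x. exp (- b * x)) has_integral 1 / b) {0<..}"
      using Gamma_integral_scaled(1)[of 1 b] that
      by (auto simp: powr_minus_divide intro: has_integral_eq[rotated])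
    from nn_integral_has_integral_lebesgue'[OF _ this] show ?thesis by simp
  qed
  have "(\<integral>\<^sup>+x\<in>{0<..}. ennreal (2 * x powr s / (x\<^sup>2 + a\<^sup>2)) \<partial>lborel) =
     (\<integral>\<^sup>+x. (\<integral>\<^sup>+v. ennreal (2 * x powr s * exp (- (x\<^sup>2 + a\<^sup>2) * v)) * indicator {0<..} x * indicator {0<..} v \<partial>lborel) \<partial>lborel)"
  proof (rule nn_integral_cong)
    fix x :: real
    have b: "x\<^sup>2 + a\<^sup>2 > 0" using a by (simp add: add_nonneg_pos)
    have "(\<integral>\<^sup>+v. ennreal (2 * x powr s * exp (- (x\<^sup>2 + a\<^sup>2) * v)) * indicator {0<..} x * indicator {0<..} v \<partial>lborel)
      = (\<integral>\<^sup>+v. (ennreal (2 * x powr s) * indicator {0<..} x) * (ennreal (exp (- (x\<^sup>2 + a\<^sup>2) * v)) * indicator {0<..} v) \<partial>lborel)"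
      by (intro nn_integral_cong) (simp add: ennreal_mult' mult_ac)
    also have "\<dots> = (ennreal (2 * x powr s) * indicator {0<..} x) * ennreal (1 / (x\<^sup>2 + a\<^sup>2))"
      by (subst nn_integral_cmult) (simp_all only: exp_int[OF b], measurable)
    also have "\<dots> = ennreal (2 * x powr s / (x\<^sup>2 + a\<^sup>2)) * indicator {0<..} x"
      using b by (simp add: mult_ac flip: ennreal_mult' ennreal_mult'')
    finally show "ennreal (2 * x powr s / (x\<^sup>2 + a\<^sup>2)) * indicator {0<..} x =
      (\<integral>\<^sup>+v. ennreal (2 * x powr s * exp (- (x\<^sup>2 + a\<^sup>2) * v)) * indicator {0<..} x * indicator {0<..} v \<partial>lborel)" ..
  qed
  also have "\<dots> = (\<integral>\<^sup>+v. (\<integral>\<^sup>+x. ennreal (2 * x powr s * exp (- (x\<^sup>2 + a\<^sup>2) * v)) * indicator {0<..} x * indicator {0<..} v \<partial>lborel) \<partial>lborel)"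
    by (rule lborel_pair.Fubini') measurable
  also have "\<dots> = (\<integral>\<^sup>+v. ennreal (Gamma ((1 + s) / 2)) *
      (ennreal (v powr ((1 - s) / 2 - 1) * exp (- a\<^sup>2 * v)) * indicator {0<..} v) \<partial>lborel)"
  proof (rule nn_integral_cong)
    fix v :: real
    show "(\<integral>\<^sup>+x. ennreal (2 * x powr s * exp (- (x\<^sup>2 + a\<^sup>2) * v)) * indicator {0<..} x * indicator {0<..} v \<partial>lborel)
      = ennreal (Gamma ((1 + s) / 2)) *
      (ennreal (v powr ((1 - s) / 2 - 1) * exp (- a\<^sup>2 * v)) * indicator {0<..} v)"
    proof (cases "v > 0")
      case True
      have "(\<integral>\<^sup>+x. ennreal (2 * x powr s * exp (- (x\<^sup>2 + a\<^sup>2) * v)) * indicator {0<..} x * indicator {0<..} v \<partial>lborel)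
        = (\<integral>\<^sup>+x. ennreal (exp (- a\<^sup>2 * v)) * (ennreal (2 * x powr s * exp (- v * x\<^sup>2)) * indicator {0<..} x) \<partial>lborel)"
      proof (rule nn_integral_cong)
        fix x :: real
        have "exp (- (x\<^sup>2 + a\<^sup>2) * v) = exp (- a\<^sup>2 * v) * exp (- v * x\<^sup>2)"
          by (simp add: algebra_simps flip: exp_add)
        hence "2 * x powr s * exp (- (x\<^sup>2 + a\<^sup>2) * v) = exp (- a\<^sup>2 * v) * (2 * x powr s * exp (- v * x\<^sup>2))"
          by simp
        thus "ennreal (2 * x powr s * exp (- (x\<^sup>2 + a\<^sup>2) * v)) * indicator {0<..} x * indicator {0<..} v =
          ennreal (exp (- a\<^sup>2 * v)) * (ennreal (2 * x powr s * exp (- v * x\<^sup>2)) * indicator {0<..} x)"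
          using True by (simp only: ennreal_mult'[OF exp_ge_zero]) (simp add: mult.assoc)
      qed
      also have "\<dots> = ennreal (exp (- a\<^sup>2 * v)) * ennreal (Gamma ((s+1)/2) * v powr (- ((s+1)/2)))"
        by (subst nn_integral_cmult, measurable)
           (subst nn_integral_has_integral_lebesgue'[OF _ Gamma_integral_gaussian], use s True in auto)
      also have "- ((s+1)/2) = (1 - s) / 2 - 1" by (simp add: field_simps)
      also have "ennreal (exp (- a\<^sup>2 * v)) * ennreal (Gamma ((s+1)/2) * v powr ((1 - s) / 2 - 1)) =
         ennreal (Gamma ((1 + s) / 2)) * ennreal (v powr ((1 - s) / 2 - 1) * exp (- a\<^sup>2 * v))"
        using Gamma_real_pos[of "(1 + s) / 2"] s
        by (subst (1 2) ennreal_mult'[symmetric]) (auto simp: add.commute algebra_simps)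
      finally show ?thesis using True by simp
    qed auto
  qed
  also have "\<dots> = ennreal (Gamma ((1 + s) / 2)) * ennreal (Gamma ((1 - s) / 2) * (a\<^sup>2) powr (- ((1 - s) / 2)))"
    by (subst nn_integral_cmult, measurable)
       (subst nn_integral_has_integral_lebesgue'[OF _ Gamma_integral_scaled(1)], use s a in auto)
  also have "(a\<^sup>2) powr (- ((1 - s) / 2)) = a powr (s - 1)"
    using a by (simp add: powr_powr diff_divide_distrib flip: powr_numeral)
  finally show ?thesis using s by (simp add: mult_ac Gamma_real_pos flip: ennreal_mult')
qed

section \<open>Trapezoidal error terms and the functional equation on an interval\<close>

text \<open>This is the trapezoidal error for exp(-u x) as a function of u. Its Peano kernel is the
  one that occurs for powers of u, so integrating over x with weight \<open>x powr (s - 1)\<close>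
  converts it into the error for powers.\<close>

lemma exp_trapezoid_error:
  fixes a x :: real
  assumes "x > 0"
  shows "((\<lambda>u. (u - a) * (a + 1 - u) / 2 * (x\<^sup>2 * exp (- u * x))) has_integral
     ((exp (- a * x) + exp (- (a + 1) * x)) / 2 - (exp (- a * x) - exp (- (a + 1) * x)) / x)) {a..a+1}"
proof -
  have "((\<lambda>u. ((u - a) * (a + 1 - u) / 2) *\<^sub>R (x\<^sup>2 * exp (- u * x))) has_integral
     ((1/2) *\<^sub>R (exp (- a * x) + exp (- (a + 1) * x)) - (- exp (- (a + 1) * x) / x - (- exp (- a * x) / x)))) {a..a+1}"
    by (rule trapezoid_error_has_integral[where g = "\<lambda>u. - x * exp (- u * x)"])
       (use assms in \<open>auto intro!: derivative_eq_intros continuous_intros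
          simp: has_real_derivative_iff_has_vector_derivative[symmetric] power2_eq_square\<close>)
  thus ?thesis using assms by (simp add: field_simps)
qed

text \<open>Error of the trapezoidal rule for \<open>\<integral> u\<^sup>-\<^sup>s du\<close> over \<open>[n, n + 1]\<close>. Since \<open>0 powr _ = 0\<close>, its value at
  \<open>n = 0\<close> is \<open>1/2 + 1 / (s - 1)\<close>; this is correct for \<open>Re s < 0\<close>, and makes the sum over
  all \<open>n\<close> equal to \<open>\<zeta>(s)\<close> there.\<close>
definition zeta_trapezoid :: "'a::{ln,real_normed_field} \<Rightarrow> nat \<Rightarrow> 'a" where
  "zeta_trapezoid s n = (of_nat n powr - s + of_nat (Suc n) powr - s) / 2
     - (of_nat (Suc n) powr (1 - s) - of_nat n powr (1 - s)) / (1 - s)"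

lemma zeta_trapezoid_has_integral_real:
  fixes s :: real
  assumes "-1 < s" "s < 0"
  shows "((\<lambda>u. (u - real n) * (real n + 1 - u) / 2 * (s * (s + 1) * u powr (- s - 2))) has_integral
     zeta_trapezoid s n) {real n..real n + 1}"
proof -
  have "((\<lambda>u. ((u - real n) * (real n + 1 - u) / 2) *\<^sub>R (s * (s + 1) * u powr (- s - 2))) has_integral
     ((1/2) *\<^sub>R (real n powr - s + (real n + 1) powr - s) -
     ((real n + 1) powr (1 - s) / (1 - s) - real n powr (1 - s) / (1 - s)))) {real n..real n+1}"
  proof (rule trapezoid_error_has_integral[where g = "\<lambda>u. - s * u powr (- s - 1)"])
    have "continuous_on {real n..real n + 1} (\<lambda>u. (u - real n) * (- s * u powr (- s - 1)))"
    \<comment> \<open>Only at n = 0 is the derivative of \<open>u powr - s\<close> unbounded. There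
      the factor u reduces it to a multiple of \<open>u powr - s\<close>, which is continuous with
      value 0 at 0 because s < 0.\<close>
    proof (cases "n = 0")
      case True
      have "continuous_on {0..1::real} (\<lambda>u. - s * u powr - s)"
        using assms by (intro continuous_intros continuous_on_powr') auto
      also have "?this \<longleftrightarrow> continuous_on {0..1::real} (\<lambda>u. (u - real n) * (- s * u powr (- s - 1)))"
      proof (rule continuous_on_cong[OF refl])
        fix u :: real assume u: "u \<in> {0..1}"
        have "u * u powr (- s - 1) = u powr - s"
          using u by (cases "u = 0") (auto simp: powr_diff)
        thus "- s * u powr - s = (u - real n) * (- s * u powr (- s - 1))"
          using True by simp
      qed
      finally show ?thesis using True by simp
    qed (auto intro!: continuous_intros)
    thus "continuous_on {real n..real n + 1} (\<lambda>u. (u - real n) *\<^sub>R (- s * u powr (- s - 1)))" by simp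
    show "continuous_on {real n..real n + 1} (\<lambda>u. u powr (1 - s) / (1 - s))"
      "continuous_on {real n..real n + 1} (\<lambda>u. u powr - s)"
      using assms by (intro continuous_intros continuous_on_powr'; auto)+
  next
    fix u assume "real n < u"
    hence u: "u > 0" by linarith
    have powr_deriv: "((\<lambda>u. u powr r) has_real_derivative r * u powr (r - 1)) (at u)" for r
      using u by (rule has_real_derivative_powr)
    show "((\<lambda>u. u powr (1 - s) / (1 - s)) has_vector_derivative u powr - s) (at u)"
      using DERIV_cdivide[OF powr_deriv[of "1 - s"], of "1 - s"] assms
      by (simp add: has_real_derivative_iff_has_vector_derivative)
    show "((\<lambda>u. u powr - s) has_vector_derivative - s * u powr (- s - 1)) (at u)"
      using powr_deriv[of "- s"] by (simp add: has_real_derivative_iff_has_vector_derivative)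
    have "- s * ((- s - 1) * u powr (- s - 1 - 1)) = s * (s + 1) * u powr (- s - 2)"
      by (simp add: algebra_simps)
    thus "((\<lambda>u. - s * u powr (- s - 1)) has_vector_derivative s * (s + 1) * u powr (- s - 2)) (at u)"
      using DERIV_cmult[OF powr_deriv[of "- s - 1"], of "- s"]
      by (simp only: has_real_derivative_iff_has_vector_derivative)
  qed
  thus ?thesis by (simp add: zeta_trapezoid_def diff_divide_distrib add.commute)
qed

text \<open>\<open>u powr (- s - 2)\<close> is a Laplace integral of \<open>x powr (s + 1)\<close>
  with constant 1 / Gamma(s + 2), so Tonelli exchanges the Peano integral over u with the integral
  over x. Dividing by the negative number s (s + 1) makes the errors nonnegative, which allows
  \<open>nn_integral\<close> throughout.\<close>

lemma zeta_trapezoid_nn_integral: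
  fixes s :: real
  assumes s: "-1 < s" "s < 0"
  defines "c \<equiv> \<lambda>n. zeta_trapezoid s n / (s * (s + 1))"
  shows "c n \<ge> 0"
    and "(\<integral>\<^sup>+x\<in>{0<..}. ennreal (x powr (s - 1) * ((exp (- real n * x) + exp (- (real n + 1) * x)) / 2 -
             (exp (- real n * x) - exp (- (real n + 1) * x)) / x)) \<partial>lborel) = ennreal (Gamma (s + 2) * c n)"
proof -
  define w where "w = (\<lambda>u. (u - real n) * (real n + 1 - u) / 2)"
  have w: "w u \<ge> 0" if "u \<in> {real n..real n + 1}" for u
    using that by (auto simp: w_def)
  have w0: "w u = 0" if "u = 0" "u \<in> {real n..real n + 1}" for u
    using that by (auto simp: w_def)
  have [measurable]: "w \<in> borel_measurable borel" unfolding w_def by measurable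
  have "s * (s + 1) \<noteq> 0" using s by auto
  hence c: "((\<lambda>u. w u * u powr (- s - 2)) has_integral c n) {real n..real n + 1}"
    unfolding w_def c_def
    by (intro has_integral_eq[OF _ has_integral_divide[OF zeta_trapezoid_has_integral_real[OF s]]])
       (simp only: mult.left_commute[of _ "s * (s + 1)"] nonzero_mult_div_cancel_left not_False_eq_True)
  show "c n \<ge> 0"
    by (rule has_integral_nonneg[OF c]) (auto intro!: mult_nonneg_nonneg w)
  let ?K = "\<lambda>x u. ennreal (x powr (s + 1) * w u * exp (- u * x)) * indicator {0<..} x * indicator {real n..real n + 1} u"
  have "(\<integral>\<^sup>+x\<in>{0<..}. ennreal (x powr (s - 1) * ((exp (- real n * x) + exp (- (real n + 1) * x)) / 2 -
      (exp (- real n * x) - exp (- (real n + 1) * x)) / x)) \<partial>lborel) = (\<integral>\<^sup>+x. (\<integral>\<^sup>+u. ?K x u \<partial>lborel) \<partial>lborel)"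
  proof (rule nn_integral_cong)
    fix x :: real
    let ?A = "(exp (- real n * x) + exp (- (real n + 1) * x)) / 2 - (exp (- real n * x) - exp (- (real n + 1) * x)) / x"
    show "ennreal (x powr (s - 1) * ?A) * indicator {0<..} x = (\<integral>\<^sup>+u. ?K x u \<partial>lborel)"
    proof (cases "x > 0")
      case True
      have "((\<lambda>u. x powr (s - 1) * (w u * (x\<^sup>2 * exp (- u * x)))) has_integral x powr (s - 1) * ?A) {real n..real n + 1}"
        unfolding w_def by (rule has_integral_mult_right exp_trapezoid_error True)+
      also have "(\<lambda>u. x powr (s - 1) * (w u * (x\<^sup>2 * exp (- u * x)))) = (\<lambda>u. x powr (s + 1) * w u * exp (- u * x))"
        using True by (auto simp: fun_eq_iff powr_diff powr_add power2_eq_square)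
      finally show ?thesis
        using nn_integral_has_integral_lebesgue'[of "{real n..real n + 1}" "\<lambda>u. x powr (s + 1) * w u * exp (- u * x)"] w True
        by simp
    qed auto
  qed
  also have "\<dots> = (\<integral>\<^sup>+u. (\<integral>\<^sup>+x. ?K x u \<partial>lborel) \<partial>lborel)"
    by (rule lborel_pair.Fubini') measurable
  also have "\<dots> = (\<integral>\<^sup>+u. ennreal (Gamma (s + 2)) * (ennreal (w u * u powr (- s - 2)) * indicator {real n..real n + 1} u) \<partial>lborel)"
  proof (rule nn_integral_cong)
    fix u :: real
    show "(\<integral>\<^sup>+x. ?K x u \<partial>lborel) =
      ennreal (Gamma (s + 2)) * (ennreal (w u * u powr (- s - 2)) * indicator {real n..real n + 1} u)"
    \<comment> \<open>At u = 0, which lies in the interval only for n = 0, the Laplace integral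
      diverges, but the weight \<open>w\<close> vanishes.\<close>
    proof (cases "u \<in> {real n..real n + 1} \<and> u \<noteq> 0")
      case True
      hence u: "u > 0" by (auto intro: le_neq_trans)
      have "(\<integral>\<^sup>+x. ?K x u \<partial>lborel) = (\<integral>\<^sup>+x. ennreal (w u) * (ennreal (x powr (s + 2 - 1) * exp (- u * x)) * indicator {0<..} x) \<partial>lborel)"
      proof (rule nn_integral_cong)
        fix x :: real
        have "x powr (s + 1) * w u * exp (- u * x) = w u * (x powr (s + 2 - 1) * exp (- u * x))" by (simp add: add.commute)
        thus "?K x u = ennreal (w u) * (ennreal (x powr (s + 2 - 1) * exp (- u * x)) * indicator {0<..} x)"
          using True w[of u] by (simp only: ennreal_mult') (simp add: mult.assoc)
      qed
      also have "\<dots> = ennreal (w u) * ennreal (Gamma (s + 2) * u powr - (s + 2))"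
        by (subst nn_integral_cmult, measurable)
           (subst nn_integral_has_integral_lebesgue'[OF _ Gamma_integral_scaled(1)], use s u in auto)
      also have "\<dots> = ennreal (Gamma (s + 2)) * ennreal (w u * u powr (- s - 2))"
        using Gamma_real_pos[of "s + 2"] s w[of u] True
        by (subst (1 2) ennreal_mult'[symmetric]) (auto simp: algebra_simps)
      finally show ?thesis using True by simp
    next
      case False
      thus ?thesis using w0 by (auto simp: indicator_def)
    qed
  qed
  also have "\<dots> = ennreal (Gamma (s + 2)) * ennreal (c n)"
    by (subst nn_integral_cmult, measurable)
       (subst nn_integral_has_integral_lebesgue'[OF _ c], use w in auto)
  also have "\<dots> = ennreal (Gamma (s + 2) * c n)"
    using Gamma_real_pos[of "s + 2"] s by (simp add: ennreal_mult')
  finally show "(\<integral>\<^sup>+x\<in>{0<..}. ennreal (x powr (s - 1) * ((exp (- real n * x) + exp (- (real n + 1) * x)) / 2 -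
             (exp (- real n * x) - exp (- (real n + 1) * x)) / x)) \<partial>lborel) = ennreal (Gamma (s + 2) * c n)" .
qed

text \<open>With r = exp(-x) the terms form a geometric series. Its sum is the function expanded in
  \<open>coth_partial_fractions\<close>, so the two expansions can be compared.\<close>

lemma exp_trapezoid_sums:
  fixes x :: real
  assumes "x > 0"
  shows "(\<lambda>n. (exp (- real n * x) + exp (- (real n + 1) * x)) / 2 -
             (exp (- real n * x) - exp (- (real n + 1) * x)) / x) sums (1 / (exp x - 1) + 1/2 - 1/x)"
proof -
  define r where "r = exp (- x)"
  have r: "0 < r" "r < 1" using assms by (auto simp: r_def)
  have e: "exp (- real n * x) = r ^ n" for n
    by (simp add: r_def flip: exp_of_nat_mult)
  have e': "exp (- (real n + 1) * x) = r ^ n * r" for n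
    using e[of "Suc n"] by (simp add: add.commute)
  have "(\<lambda>n. ((1 + r) / 2 - (1 - r) / x) * r ^ n) sums (((1 + r) / 2 - (1 - r) / x) * (1 / (1 - r)))"
    using r by (intro sums_mult geometric_sums) auto
  also have "(\<lambda>n. ((1 + r) / 2 - (1 - r) / x) * r ^ n) = (\<lambda>n. (exp (- real n * x) + exp (- (real n + 1) * x)) / 2 -
             (exp (- real n * x) - exp (- (real n + 1) * x)) / x)"
    unfolding e e' using assms by (auto simp: fun_eq_iff field_simps)
  also have "((1 + r) / 2 - (1 - r) / x) * (1 / (1 - r)) = 1 / (1 / r - 1) + 1/2 - 1/x"
    using assms r by (simp add: field_simps)
  also have "1 / r = exp x" by (simp add: r_def exp_minus inverse_eq_divide)
  finally show ?thesis .
qed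

text \<open>The same function is integrated against \<open>x powr (s - 1)\<close> through its two
  expansions: trapezoidal errors give the left side, partial fractions the right side. All terms are
  nonnegative, so sums and integrals commute without prior convergence.\<close>

lemma zeta_functional_equation_real:
  fixes s :: real
  assumes s: "-1 < s" "s < 0"
  shows "summable (zeta_trapezoid s)"
    and "Gamma s * suminf (zeta_trapezoid s) =
      (2 * pi) powr (s - 1) * Gamma ((1 + s) / 2) * Gamma ((1 - s) / 2) * (\<Sum>n. real (Suc n) powr (s - 1))"
proof -
  define c where "c = (\<lambda>n. zeta_trapezoid s n / (s * (s + 1)))"
  define C where "C = Gamma ((1 + s) / 2) * Gamma ((1 - s) / 2)"
  define A where "A = (\<lambda>n x. (exp (- real n * x) + exp (- (real n + 1) * x)) / 2 -
             (exp (- real n * x) - exp (- (real n + 1) * x)) / x)"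
  have c: "c n \<ge> 0" for n using zeta_trapezoid_nn_integral(1)[OF s] by (simp add: c_def)
  have G: "Gamma (s + 2) > 0" using s by (intro Gamma_real_pos) auto
  have C: "C > 0" unfolding C_def using s by (intro mult_pos_pos Gamma_real_pos) auto
  have sum: "summable (\<lambda>n. real (Suc n) powr (s - 1))"
    using s by (subst summable_Suc_iff) (simp add: summable_real_powr_iff)
  have A: "A n x \<ge> 0" if "x > 0" for n x
    using exp_trapezoid_error[OF that, of "real n"]
    unfolding A_def by (rule has_integral_nonneg) auto
  have A_meas [measurable]: "A n \<in> borel_measurable borel" for n unfolding A_def by measurable
  have ps: "x powr (s - 1) * x = x powr s" if "x > 0" for x
    using that by (simp add: powr_diff)
  have "(\<Sum>n. ennreal (Gamma (s + 2) * c n)) = (\<Sum>n. (\<integral>\<^sup>+x\<in>{0<..}. ennreal (x powr (s - 1) * A n x) \<partial>lborel))"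
    using zeta_trapezoid_nn_integral(2)[OF s] by (simp add: c_def A_def)
  also have "\<dots> = (\<integral>\<^sup>+x. (\<Sum>n. ennreal (x powr (s - 1) * A n x) * indicator {0<..} x) \<partial>lborel)"
    by (rule nn_integral_suminf[symmetric]) measurable
  also have "\<dots> = (\<integral>\<^sup>+x. (\<Sum>n. ennreal (2 * x powr s / (x\<^sup>2 + (2 * pi * real (Suc n))\<^sup>2)) * indicator {0<..} x) \<partial>lborel)"
  proof (rule nn_integral_cong)
    fix x :: real
    show "(\<Sum>n. ennreal (x powr (s - 1) * A n x) * indicator {0<..} x) =
      (\<Sum>n. ennreal (2 * x powr s / (x\<^sup>2 + (2 * pi * real (Suc n))\<^sup>2)) * indicator {0<..} x)"
    proof (cases "x > 0")
      case True
      have "(\<lambda>n. x powr (s - 1) * A n x) sums (x powr (s - 1) * (1 / (exp x - 1) + 1/2 - 1/x))"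
        unfolding A_def by (intro sums_mult exp_trapezoid_sums True)
      hence "(\<Sum>n. ennreal (x powr (s - 1) * A n x)) = ennreal (x powr (s - 1) * (1 / (exp x - 1) + 1/2 - 1/x))"
        using True A by (intro suminf_ennreal_eq) auto
      moreover have "(\<lambda>n. x powr (s - 1) * (2 * x / (x\<^sup>2 + (2 * pi * real (Suc n))\<^sup>2))) sums
          (x powr (s - 1) * (1 / (exp x - 1) + 1/2 - 1/x))"
        by (intro sums_mult coth_partial_fractions True)
      hence "(\<lambda>n. 2 * x powr s / (x\<^sup>2 + (2 * pi * real (Suc n))\<^sup>2)) sums
          (x powr (s - 1) * (1 / (exp x - 1) + 1/2 - 1/x))"
        unfolding ps[OF True, symmetric] by (simp only: times_divide_eq_right mult.left_commute[of _ 2])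
      hence "(\<Sum>n. ennreal (2 * x powr s / (x\<^sup>2 + (2 * pi * real (Suc n))\<^sup>2))) =
          ennreal (x powr (s - 1) * (1 / (exp x - 1) + 1/2 - 1/x))"
        by (intro suminf_ennreal_eq) auto
      ultimately show ?thesis using True by simp
    qed auto
  qed
  also have "\<dots> = (\<Sum>n. (\<integral>\<^sup>+x\<in>{0<..}. ennreal (2 * x powr s / (x\<^sup>2 + (2 * pi * real (Suc n))\<^sup>2)) \<partial>lborel))"
    by (rule nn_integral_suminf) measurable
  also have "\<dots> = (\<Sum>n. ennreal (C * (2 * pi) powr (s - 1) * real (Suc n) powr (s - 1)))"
  proof (rule suminf_cong)
    fix n
    show "(\<integral>\<^sup>+x\<in>{0<..}. ennreal (2 * x powr s / (x\<^sup>2 + (2 * pi * real (Suc n))\<^sup>2)) \<partial>lborel) =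
       ennreal (C * (2 * pi) powr (s - 1) * real (Suc n) powr (s - 1))"
      using nn_integral_powr_over_square_add[of s "2 * pi * real (Suc n)"] s
      by (simp add: C_def powr_mult mult.assoc)
  qed
  also have "\<dots> = ennreal (C * (2 * pi) powr (s - 1) * (\<Sum>n. real (Suc n) powr (s - 1)))"
    using C sum by (intro suminf_ennreal_eq sums_mult summable_sums) auto
  finally have eq: "(\<Sum>n. ennreal (Gamma (s + 2) * c n)) =
      ennreal (C * (2 * pi) powr (s - 1) * (\<Sum>n. real (Suc n) powr (s - 1)))" .
  \<comment> \<open>Convergence of the trapezoidal series is deduced from the finiteness of the
    partial fraction side.\<close>
  have sc: "summable (\<lambda>n. Gamma (s + 2) * c n)"
    by (rule summable_suminf_not_top) (use G c eq in auto)
  have "(\<Sum>n. ennreal (Gamma (s + 2) * c n)) = ennreal (\<Sum>n. Gamma (s + 2) * c n)"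
    using sc G c by (intro suminf_ennreal_eq summable_sums) auto
  hence "(\<Sum>n. Gamma (s + 2) * c n) = C * (2 * pi) powr (s - 1) * (\<Sum>n. real (Suc n) powr (s - 1))"
    using eq C c G sc sum by (simp add: suminf_nonneg)
  \<comment> \<open>Two steps of the recurrence for Gamma produce exactly the factor s (s + 1)
    divided out in \<open>c\<close>.\<close>
  moreover have "(\<lambda>n. Gamma (s + 2) * c n) = (\<lambda>n. Gamma s * zeta_trapezoid s n)"
  proof -
    have "s \<notin> \<int>\<^sub>\<le>\<^sub>0" "s + 1 \<notin> \<int>\<^sub>\<le>\<^sub>0" using s by (auto elim!: nonpos_Ints_cases)
    hence "Gamma (s + 2) = (s + 1) * (s * Gamma s)"
      using Gamma_plus1[of s] Gamma_plus1[of "s + 1"] by (simp add: add_ac)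
    thus ?thesis using s by (auto simp: c_def fun_eq_iff)
  qed
  moreover have G0: "Gamma s \<noteq> 0" using s by (auto simp: Gamma_eq_zero_iff elim!: nonpos_Ints_cases)
  ultimately have *: "(\<Sum>n. Gamma s * zeta_trapezoid s n) = C * (2 * pi) powr (s - 1) * (\<Sum>n. real (Suc n) powr (s - 1))"
    and "summable (\<lambda>n. Gamma s * zeta_trapezoid s n)" using sc by auto
  thus "summable (zeta_trapezoid s)" using G0 by (simp add: summable_cmult_iff)
  thus "Gamma s * suminf (zeta_trapezoid s) =
      (2 * pi) powr (s - 1) * Gamma ((1 + s) / 2) * Gamma ((1 - s) / 2) * (\<Sum>n. real (Suc n) powr (s - 1))"
    using * by (subst (asm) suminf_mult) (auto simp: C_def mult_ac)
qed

section \<open>The zeta function to the right of -1\<close>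

lemma zeta_trapezoid_has_integral_complex:
  fixes s :: complex
  assumes "s \<noteq> 1" "n > 0"
  shows "((\<lambda>u. ((u - real n) * (real n + 1 - u) / 2) *\<^sub>R (s * (s + 1) * of_real u powr (- s - 2))) has_integral
     zeta_trapezoid s n) {real n..real n + 1}"
proof -
  have powr_deriv: "((\<lambda>u. of_real u powr r) has_vector_derivative r * of_real u powr (r - 1)) (at u within S)"
    if "u > 0" for r :: complex and u :: real and S
    using that by (intro has_vector_derivative_real_field) (auto intro!: derivative_eq_intros)
  have cont: "continuous_on {real n..real n + 1} (\<lambda>u. of_real u powr r)" for r :: complex
    using assms by (intro continuous_on_vector_derivative[OF powr_deriv]) auto
  have "((\<lambda>u. ((u - real n) * (real n + 1 - u) / 2) *\<^sub>R (s * (s + 1) * of_real u powr (- s - 2))) has_integral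
     ((1/2) *\<^sub>R (of_real (real n) powr - s + of_real (real n + 1) powr - s) -
     (of_real (real n + 1) powr (1 - s) / (1 - s) - of_real (real n) powr (1 - s) / (1 - s)))) {real n..real n+1}"
  proof (rule trapezoid_error_has_integral[where g = "\<lambda>u. - s * of_real u powr (- s - 1)"])
    fix u assume "real n < u"
    hence u: "u > 0" by linarith
    show "((\<lambda>u. of_real u powr (1 - s) / (1 - s)) has_vector_derivative of_real u powr - s) (at u)"
      using has_vector_derivative_divide[OF powr_deriv[OF u, of "1 - s" UNIV], of "1 - s"] assms by simp
    show "((\<lambda>u. of_real u powr - s) has_vector_derivative - s * of_real u powr (- s - 1)) (at u)"
      using powr_deriv[OF u, of "- s" UNIV] by simp
    have "- s * ((- s - 1) * of_real u powr (- s - 1 - 1)) = s * (s + 1) * of_real u powr (- s - 2)"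
      by (simp add: algebra_simps)
    thus "((\<lambda>u. - s * of_real u powr (- s - 1)) has_vector_derivative s * (s + 1) * of_real u powr (- s - 2)) (at u)"
      using has_vector_derivative_mult_right[OF powr_deriv[OF u, of "- s - 1" UNIV], of "- s"] by simp
  qed (intro continuous_intros cont; use assms in auto)+
  thus ?thesis by (simp add: zeta_trapezoid_def diff_divide_distrib add.commute scaleR_conv_of_real)
qed

text \<open>Bound the Peano integral with weight at most 1. The separate lower bound
  \<open>r\<close> for \<open>Re s\<close> makes the power of n uniform in s, as the Weierstrass
  test requires.\<close>

lemma norm_zeta_trapezoid_le:
  fixes s :: complex
  assumes "s \<noteq> 1" "n > 0" "r \<le> Re s" "r > -1"
  shows "norm (zeta_trapezoid s n) \<le> norm s * norm (s + 1) * real n powr (- r - 2)"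
proof -
  have "norm (zeta_trapezoid s n) \<le> norm s * norm (s + 1) * real n powr (- r - 2) * measure lborel (cbox (real n) (real n + 1))"
  proof (rule has_integral_bound)
    show "((\<lambda>u. ((u - real n) * (real n + 1 - u) / 2) *\<^sub>R (s * (s + 1) * of_real u powr (- s - 2))) has_integral
       zeta_trapezoid s n) (cbox (real n) (real n + 1))"
      using zeta_trapezoid_has_integral_complex[OF assms(1,2)] by simp
    fix u assume "u \<in> cbox (real n) (real n + 1)"
    hence u: "real n \<le> u" "u \<le> real n + 1" by auto
    have "(u - real n) * (real n + 1 - u) \<le> 1 * 1" using u by (intro mult_mono) auto
    hence w: "\<bar>(u - real n) * (real n + 1 - u) / 2\<bar> \<le> 1" using u by simp
    have "norm (of_real u powr (- s - 2)) = u powr (- Re s - 2)"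
      using u assms by (subst norm_powr_real_powr) auto
    also have "\<dots> \<le> real n powr (- Re s - 2)"
      using u assms by (intro powr_mono2') auto
    also have "\<dots> \<le> real n powr (- r - 2)"
      using assms by (intro powr_mono) auto
    finally have "norm (of_real u powr (- s - 2)) \<le> real n powr (- r - 2)" .
    hence "\<bar>(u - real n) * (real n + 1 - u) / 2\<bar> * (norm s * norm (s + 1) * norm (of_real u powr (- s - 2)))
       \<le> 1 * (norm s * norm (s + 1) * real n powr (- r - 2))"
      by (intro mult_mono w order_refl mult_nonneg_nonneg) auto
    thus "norm (((u - real n) * (real n + 1 - u) / 2) *\<^sub>R (s * (s + 1) * of_real u powr (- s - 2)))
      \<le> norm s * norm (s + 1) * real n powr (- r - 2)"
      by (simp only: norm_scaleR norm_mult mult_1_left)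
  qed auto
  thus ?thesis by simp
qed

lemma summable_Suc_powr:
  fixes r :: real
  assumes "r > -1"
  shows "summable (\<lambda>n. real (Suc n) powr (- r - 2))"
  using assms by (subst summable_Suc_iff[of "\<lambda>n. real n powr (- r - 2)"]) (simp add: summable_real_powr_iff)

text \<open>Euler-Maclaurin form of zeta(s) for Re s > -1. The part outside the sum is the value of
  \<open>zeta_trapezoid s 0\<close>, and it carries the pole at 1.\<close>

definition zeta_right :: "complex \<Rightarrow> complex" where
  "zeta_right s = 1/2 + 1 / (s - 1) + (\<Sum>n. zeta_trapezoid s (Suc n))"

lemma summable_zeta_trapezoid:
  fixes s :: complex
  assumes "s \<noteq> 1" "Re s > -1"
  shows "summable (\<lambda>n. zeta_trapezoid s (Suc n))"
proof (rule summable_comparison_test')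
  show "summable (\<lambda>n. norm s * norm (s + 1) * real (Suc n) powr (- Re s - 2))"
    by (intro summable_mult summable_Suc_powr assms)
  show "norm (zeta_trapezoid s (Suc n)) \<le> norm s * norm (s + 1) * real (Suc n) powr (- Re s - 2)" for n
    by (intro norm_zeta_trapezoid_le assms) auto
qed

text \<open>Taking r = 0 in the termwise bound gives quadratic growth in s, which is all that the
  decay of the contour integrand requires.\<close>

lemma norm_zeta_right_le:
  assumes "s \<noteq> 1" "Re s \<ge> 0"
  shows "norm (zeta_right s) \<le> 1/2 + 1 / norm (s - 1) + norm s * norm (s + 1) * (\<Sum>n. real (Suc n) powr - 2)"
proof -
  have "norm (\<Sum>n. zeta_trapezoid s (Suc n)) \<le> (\<Sum>n. norm s * norm (s + 1) * real (Suc n) powr (- 0 - 2))"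
    using assms by (intro norm_suminf_le norm_zeta_trapezoid_le summable_mult summable_Suc_powr) auto
  also have "\<dots> = norm s * norm (s + 1) * (\<Sum>n. real (Suc n) powr - 2)"
    using summable_Suc_powr[of 0] by (subst suminf_mult) auto
  finally have *: "norm (\<Sum>n. zeta_trapezoid s (Suc n)) \<le> norm s * norm (s + 1) * (\<Sum>n. real (Suc n) powr - 2)" .
  have "norm (zeta_right s) \<le> norm (1/2 :: complex) + norm (1 / (s - 1)) + norm (\<Sum>n. zeta_trapezoid s (Suc n))"
    unfolding zeta_right_def by (intro norm_triangle_le add_mono) auto
  thus ?thesis using * by (simp add: norm_divide)
qed

lemma zeta_right_holomorphic: "zeta_right holomorphic_on ({s. Re s > -1} - {1})"
proof -
  have op: "open ({s. Re s > -1} - {1})"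
    by (intro open_Diff open_halfspace_Re_gt) auto
  have "(\<lambda>s. \<Sum>n. zeta_trapezoid s (Suc n)) holomorphic_on ({s. Re s > -1} - {1})"
  proof (rule holomorphic_uniform_sequence[OF op])
    show "(\<lambda>s. \<Sum>n<N. zeta_trapezoid s (Suc n)) holomorphic_on ({s. Re s > -1} - {1})" for N
      unfolding zeta_trapezoid_def by (intro holomorphic_intros) auto
    fix x assume "x \<in> {s. Re s > -1} - {1::complex}"
    then obtain d where d: "d > 0" "cball x d \<subseteq> {s. Re s > -1} - {1}"
      using op open_contains_cball by blast
    \<comment> \<open>The smallest real part on the closed disc, attained at x - d; that point lies
      in the half-plane, hence r > -1.\<close>
    define r where "r = Re x - d"
    have "x - of_real d \<in> cball x d" using d by (simp add: dist_norm)
    hence "x - of_real d \<in> {s. Re s > -1} - {1}" using d by blast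
    hence r: "r > -1" by (simp add: r_def)
    define B where "B = (norm x + d) * (norm x + d + 1)"
    have "uniform_limit (cball x d) (\<lambda>N s. \<Sum>n<N. zeta_trapezoid s (Suc n)) (\<lambda>s. \<Sum>n. zeta_trapezoid s (Suc n)) sequentially"
    proof (rule Weierstrass_m_test)
      show "summable (\<lambda>n. B * real (Suc n) powr (- r - 2))"
        by (intro summable_mult summable_Suc_powr r)
      fix n s assume s: "s \<in> cball x d"
      have "\<bar>Re (x - s)\<bar> \<le> d" using s abs_Re_le_cmod[of "x - s"] by (simp add: dist_norm)
      hence "r \<le> Re s" by (simp add: r_def)
      hence "norm (zeta_trapezoid s (Suc n)) \<le> norm s * norm (s + 1) * real (Suc n) powr (- r - 2)"
        using s d r by (intro norm_zeta_trapezoid_le) auto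
      also have "norm s \<le> norm x + d"
        using s norm_triangle_sub[of s x] by (simp add: dist_norm norm_minus_commute)
      hence "norm s * norm (s + 1) \<le> B"
        unfolding B_def using norm_triangle_ineq[of s 1] d by (intro mult_mono) auto
      finally show "norm (zeta_trapezoid s (Suc n)) \<le> B * real (Suc n) powr (- r - 2)"
        by (simp add: mult_right_mono)
    qed
    thus "\<exists>d>0. cball x d \<subseteq> {s. Re s > -1} - {1} \<and>
       uniform_limit (cball x d) (\<lambda>N s. \<Sum>n<N. zeta_trapezoid s (Suc n)) (\<lambda>s. \<Sum>n. zeta_trapezoid s (Suc n)) sequentially"
      using d by blast
  qed
  thus ?thesis unfolding zeta_right_def by (intro holomorphic_intros) auto
qed

text \<open>The integral parts of the trapezoidal errors telescope and neighbouring halves combine,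
  so partial sums of the Dirichlet series differ from those of \<open>zeta_trapezoid\<close> by
  boundary terms. For Re s > 1 the moving boundary terms tend to 0.\<close>

lemma zeta_right_sums:
  assumes s: "Re s > 1"
  shows "(\<lambda>n. of_nat (Suc n) powr - s) sums zeta_right s"
proof -
  have s1: "s \<noteq> 1" using s by auto
  have part: "(\<Sum>k<N. of_nat (Suc k) powr - s) = (\<Sum>k<N. zeta_trapezoid s (Suc k)) + 1/2
     - of_nat (Suc N) powr - s / 2 + (of_nat (Suc N) powr (1 - s) - 1) / (1 - s)" for N
    by (induction N) (simp_all add: zeta_trapezoid_def diff_divide_distrib add_divide_distrib)
  have lim: "(\<lambda>N. of_nat (Suc N) powr w) \<longlonglongrightarrow> 0" if "Re w < 0" for w :: complex
    using that by (intro tendsto_neg_powr_complex_of_nat filterlim_Suc)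
  have "(\<lambda>N. \<Sum>k<N. of_nat (Suc k) powr - s) \<longlonglongrightarrow> (\<Sum>n. zeta_trapezoid s (Suc n)) + 1/2 - 0/2 + (0 - 1) / (1 - s)"
    unfolding part using s s1
    by (intro tendsto_intros lim summable_LIMSEQ summable_zeta_trapezoid) auto
  also have "(\<Sum>n. zeta_trapezoid s (Suc n)) + 1/2 - 0/2 + (0 - 1) / (1 - s) = zeta_right s"
    using s1 by (simp add: zeta_right_def field_simps)
  finally show ?thesis by (simp add: sums_def)
qed

lemma zeta_trapezoid_of_real: "zeta_trapezoid (of_real s :: complex) n = of_real (zeta_trapezoid s n)"
proof -
  have "of_nat m powr complex_of_real x = of_real (real m powr x)" for m x
    using powr_of_real[of "real m" x] by simp
  from this[of _ "- s"] this[of _ "1 - s"] show ?thesis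
    by (simp add: zeta_trapezoid_def del: of_nat_Suc)
qed

text \<open>For s in this interval \<open>zeta_right s\<close> is the trapezoidal series from n = 0,
  and 1 - s > 1, so the Dirichlet series represents \<open>zeta_right (1 - s)\<close>.\<close>

lemma zeta_right_functional_equation_real:
  fixes s :: real
  assumes s: "-1 < s" "s < 0"
  shows "of_real (Gamma s) * zeta_right (of_real s) =
    of_real ((2 * pi) powr (s - 1) * Gamma ((1 + s) / 2) * Gamma ((1 - s) / 2)) * zeta_right (1 - of_real s)"
proof -
  note FE = zeta_functional_equation_real[OF s]
  have "suminf (zeta_trapezoid s) = (\<Sum>n. zeta_trapezoid s (Suc n)) + zeta_trapezoid s 0"
    using suminf_split_head[OF FE(1)] by simp
  hence 1: "zeta_right (of_real s) = of_real (suminf (zeta_trapezoid s))"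
    using FE(1) summable_Suc_iff[of "zeta_trapezoid s"] s
    by (simp add: zeta_right_def zeta_trapezoid_of_real suminf_of_real[symmetric])
       (simp add: zeta_trapezoid_def field_simps)
  have sum: "summable (\<lambda>n. real (Suc n) powr (s - 1))"
    using summable_Suc_powr[of "- s - 1"] s by simp
  have "(\<lambda>n. of_nat (Suc n) powr - (1 - of_real s)) sums zeta_right (1 - of_real s)"
    using s by (intro zeta_right_sums) auto
  moreover have "(\<lambda>n. of_nat (Suc n) powr - (1 - complex_of_real s)) = (\<lambda>n. of_real (real (Suc n) powr (s - 1)))"
    by (simp add: powr_of_real[symmetric] fun_eq_iff del: of_nat_Suc)
  ultimately have "(\<lambda>n. complex_of_real (real (Suc n) powr (s - 1))) sums zeta_right (1 - of_real s)" by simp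
  moreover have "(\<lambda>n. complex_of_real (real (Suc n) powr (s - 1))) sums of_real (\<Sum>n. real (Suc n) powr (s - 1))"
    using sum by (intro sums_of_real summable_sums)
  ultimately have 2: "zeta_right (1 - of_real s) = of_real (\<Sum>n. real (Suc n) powr (s - 1))"
    by (rule sums_unique2)
  show ?thesis unfolding 1 2 using FE(2) by (simp flip: of_real_mult)
qed

section \<open>Functional equation and continuation to the plane\<close>

text \<open>The completed zeta function \<open>\<pi>\<^sup>-\<^sup>s\<^sup>/\<^sup>2 \<Gamma>(s/2) \<zeta>(s)\<close> divided by the symmetric factor
  \<open>\<Gamma>(s/2) \<Gamma>((1 - s)/2)\<close>, which removes the poles coming from the Gamma function.\<close>
definition zeta_side :: "complex \<Rightarrow> complex" where
  "zeta_side s = of_real pi powr (- s / 2) * rGamma ((1 - s) / 2) * zeta_right s"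

text \<open>Legendre duplication at s/2 replaces Gamma(s) by Gamma(s/2) Gamma((1 + s)/2); the second
  factor cancels, leaving the symmetric form.\<close>

lemma zeta_side_reflect_real:
  fixes s :: real
  assumes s: "-1 < s" "s < 0"
  shows "zeta_side (of_real s) = zeta_side (1 - of_real s)"
proof -
  have nz: "s / 2 \<notin> \<int>\<^sub>\<le>\<^sub>0" "s / 2 + 1 / 2 \<notin> \<int>\<^sub>\<le>\<^sub>0" "s \<notin> \<int>\<^sub>\<le>\<^sub>0" "(1 - s) / 2 \<notin> \<int>\<^sub>\<le>\<^sub>0"
    using s by (auto elim!: nonpos_Ints_cases)
  have c: "complex_of_real x \<notin> \<int>\<^sub>\<le>\<^sub>0" if "x \<notin> \<int>\<^sub>\<le>\<^sub>0" for x
    using that by (simp add: of_real_in_nonpos_Ints_iff)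
  have G: "Gamma (complex_of_real x) = of_real (Gamma x)" for x by (rule Gamma_complex_of_real)
  have "of_real (Gamma (s / 2)) * of_real (Gamma (s / 2 + 1 / 2)) =
     exp ((1 - of_real s) * of_real (ln 2)) * complex_of_real (sqrt pi) * of_real (Gamma s)"
    using Gamma_legendre_duplication[of "of_real (s / 2)"] c[OF nz(1)] c[OF nz(2)]
    by (simp add: G[symmetric] del: of_real_divide) simp
  also have "exp ((1 - of_real s) * complex_of_real (ln 2)) = of_real (2 powr (1 - s))"
    by (simp add: powr_def flip: exp_of_real)
  finally have dup: "Gamma (s / 2) * Gamma ((1 + s) / 2) = 2 powr (1 - s) * sqrt pi * Gamma s"
    by (simp add: add_divide_distrib add.commute flip: of_real_mult)
  have pw: "2 powr (1 - s) * sqrt pi * (2 * pi) powr (s - 1) = pi powr (s - 1/2)"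
  proof -
    have "2 powr (1 - s) * (2 powr (s - 1)) = (1::real)" by (simp flip: powr_add)
    moreover have "pi powr (1/2) * pi powr (s - 1) = pi powr (s - 1/2)" by (simp flip: powr_add)
    ultimately show ?thesis by (simp add: powr_mult powr_half_sqrt mult_ac)
  qed
  define R where "R = Gamma ((1 + s) / 2)"
  have R: "R \<noteq> 0" unfolding R_def using s by (intro less_imp_neq[OF Gamma_real_pos, symmetric]) auto
  have "of_real R * (of_real (Gamma (s / 2)) * zeta_right (of_real s)) =
      of_real (2 powr (1 - s) * sqrt pi) * (of_real (Gamma s) * zeta_right (of_real s))"
    using arg_cong[OF dup, of complex_of_real] by (simp add: R_def mult_ac)
  also have "\<dots> = of_real (2 powr (1 - s) * sqrt pi * (2 * pi) powr (s - 1)) * of_real R * of_real (Gamma ((1 - s) / 2)) * zeta_right (1 - of_real s)"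
    unfolding zeta_right_functional_equation_real[OF s] by (simp add: R_def)
  also have "\<dots> = of_real R * (of_real (pi powr (s - 1/2)) * of_real (Gamma ((1 - s) / 2)) * zeta_right (1 - of_real s))"
    unfolding pw by simp
  finally have "of_real (Gamma (s / 2)) * zeta_right (of_real s) =
      of_real (pi powr (s - 1/2)) * of_real (Gamma ((1 - s) / 2)) * zeta_right (1 - of_real s)"
    using R by simp
  \<comment> \<open>Multiplying by both reciprocal Gamma factors leaves one of them on each side, as
    in \<open>zeta_side\<close>.\<close>
  hence "of_real (pi powr (- s / 2)) * of_real (rGamma (s / 2)) * of_real (rGamma ((1 - s) / 2)) * (of_real (Gamma (s / 2)) * zeta_right (of_real s)) =
      of_real (pi powr (- s / 2)) * of_real (rGamma (s / 2)) * of_real (rGamma ((1 - s) / 2)) *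
      (of_real (pi powr (s - 1/2)) * of_real (Gamma ((1 - s) / 2)) * zeta_right (1 - of_real s))" by simp
  hence "of_real (rGamma (s / 2) * Gamma (s / 2)) * (of_real (pi powr (- s / 2)) * of_real (rGamma ((1 - s) / 2)) * zeta_right (of_real s)) =
      of_real (rGamma ((1 - s) / 2) * Gamma ((1 - s) / 2)) *
      (of_real (pi powr (- s / 2) * pi powr (s - 1/2)) * of_real (rGamma (s / 2)) * zeta_right (1 - of_real s))"
    by (simp only: of_real_mult mult_ac)
  also have "rGamma (s / 2) * Gamma (s / 2) = 1"
    using nz(1) by (simp add: Gamma_def rGamma_eq_zero_iff)
  also have "rGamma ((1 - s) / 2) * Gamma ((1 - s) / 2) = 1"
    using nz(4) by (simp add: Gamma_def rGamma_eq_zero_iff)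
  also have "pi powr (- s / 2) * pi powr (s - 1/2) = pi powr (- s / 2 + (s - 1/2))"
    by (rule powr_add[symmetric])
  also have "- s / 2 + (s - 1/2) = - (1 - s) / 2" by (simp add: field_simps)
  finally have "of_real (pi powr (- s / 2)) * of_real (rGamma ((1 - s) / 2)) * zeta_right (of_real s) =
      of_real (pi powr (- (1 - s) / 2)) * of_real (rGamma (s / 2)) * zeta_right (1 - of_real s)" by simp
  moreover have "complex_of_real (pi powr x) = of_real pi powr of_real x" for x
    by (simp add: powr_of_real)
  moreover have "complex_of_real (rGamma x) = rGamma (of_real x)" for x
    by (simp add: rGamma_complex_of_real)
  ultimately show ?thesis by (simp add: zeta_side_def)
qed

text \<open>Identity theorem on the strip, starting from the real interval. \<open>rGamma\<close> is
  entire, so only the pole of \<open>zeta_right\<close> at 1 and its mirror image 0 are removed; the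
  strip stays connected.\<close>

lemma zeta_side_reflect:
  assumes "-1 < Re s" "Re s < 2" "s \<noteq> 0" "s \<noteq> 1"
  shows "zeta_side s = zeta_side (1 - s)"
proof -
  define S where "S = {s. -1 < Re s} \<inter> {s. Re s < 2} - {0, 1::complex}"
  have "open S" unfolding S_def
    by (intro open_Diff open_Int open_halfspace_Re_gt open_halfspace_Re_lt) auto
  have "connected S" unfolding S_def
    by (intro connected_open_delete_finite open_Int open_halfspace_Re_gt open_halfspace_Re_lt
        convex_connected convex_Int convex_halfspace_Re_gt convex_halfspace_Re_lt) auto
  have h1: "zeta_right holomorphic_on S"
    by (rule holomorphic_on_subset[OF zeta_right_holomorphic]) (auto simp: S_def)
  have h2: "(\<lambda>s. zeta_right (1 - s)) holomorphic_on S"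
    by (rule holomorphic_on_compose_gen[OF _ zeta_right_holomorphic, unfolded o_def])
       (auto simp: S_def intro!: holomorphic_intros)
  have "zeta_side s - zeta_side (1 - s) = 0"
  proof (rule analytic_continuation[where f = "\<lambda>s. zeta_side s - zeta_side (1 - s)"])
    show "(\<lambda>s. zeta_side s - zeta_side (1 - s)) holomorphic_on S"
      unfolding zeta_side_def by (intro holomorphic_intros h1 h2) auto
    show "of_real ` {-1<..<0} \<subseteq> S" by (auto simp: S_def)
    show "of_real (-1/2) \<in> S" by (auto simp: S_def complex_eq_iff)
    show "complex_of_real (-1/2) islimpt of_real ` {-1<..<0}"
      unfolding islimpt_approachable
    proof (intro allI impI)
      fix e :: real assume "e > 0"
      \<comment> \<open>The cap 1/4 keeps the approximating point inside the interval for large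
        e.\<close>
      define x where "x = -1/2 + min (e / 2) (1/4)"
      have "x \<in> {-1<..<0}" "x \<noteq> -1/2" "dist x (-1/2) < e"
        using \<open>e > 0\<close> by (auto simp: x_def dist_real_def min_def)
      moreover have "dist (complex_of_real x) (of_real (-1/2)) = dist x (-1/2)"
        by (rule dist_of_real)
      ultimately show "\<exists>x'\<in>of_real ` {- 1<..<0}. x' \<noteq> complex_of_real (- 1 / 2) \<and> dist x' (complex_of_real (- 1 / 2)) < e"
        by (intro bexI[of _ "of_real x"]) (auto simp del: of_real_divide)
    qed
  qed (use \<open>open S\<close> \<open>connected S\<close> zeta_side_reflect_real assms in \<open>auto simp: S_def\<close>)
  thus ?thesis by simp
qed

lemma riemann_zeta_unique:
  assumes "f holomorphic_on - {1}" "\<And>s. 1 < Re s \<Longrightarrow> f s = (\<Sum>n. 1 / (of_nat (Suc n)) powr s)" "f 1 = 0"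
    and "g holomorphic_on - {1}" "\<And>s. 1 < Re s \<Longrightarrow> g s = (\<Sum>n. 1 / (of_nat (Suc n)) powr s)" "g 1 = 0"
  shows "f = g"
proof
  fix s :: complex
  have "connected (- {1::complex})"
    using connected_open_delete_finite[of "UNIV :: complex set" "{1}"] connected_UNIV
    by (auto simp: Compl_eq_Diff_UNIV)
  show "f s = g s"
  proof (cases "s = 1")
    case False
    show ?thesis
      by (rule analytic_continuation_open[of "{s. Re s > 1}" "- {1}"])
         (use assms \<open>connected (- {1})\<close> False in \<open>auto simp: open_halfspace_Re_gt intro!: exI[of _ 2]\<close>)
  qed (use assms in auto)
qed

text \<open>Glue \<open>zeta_right\<close> to its reflection: the two formulas agree on -1 < Re s <
  0 by \<open>zeta_side_reflect\<close>. The glued function meets the definite description, and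
  uniqueness identifies it with \<open>riemann_zeta\<close>.\<close>

lemma riemann_zeta_props:
  shows riemann_zeta_holomorphic: "riemann_zeta holomorphic_on - {1}"
    and riemann_zeta_eq_zeta_right: "\<And>s. Re s > -1 \<Longrightarrow> s \<noteq> 1 \<Longrightarrow> riemann_zeta s = zeta_right s"
proof -
  \<comment> \<open>Obtained by solving \<open>zeta_side s = zeta_side (1 - s)\<close> for
    \<open>zeta_right s\<close>; the Gamma factor has no poles for Re s < 0.\<close>
  define fe_factor where "fe_factor s = of_real pi powr (s - 1/2) * Gamma ((1 - s) / 2) * rGamma (s / 2)" for s :: complex
  define f where "f s = (if s = 1 then 0 else if Re s > -1 then zeta_right s else fe_factor s * zeta_right (1 - s))" for s
  have f_left: "f s = fe_factor s * zeta_right (1 - s)" if "Re s < 0" for s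
  proof (cases "Re s > -1")
    case True
    have nz: "(1 - s) / 2 \<notin> \<int>\<^sub>\<le>\<^sub>0"
      using that by (auto elim!: nonpos_Ints_cases simp: complex_eq_iff)
    have "s \<noteq> 0" "s \<noteq> 1" using that by auto
    hence "zeta_side s = zeta_side (1 - s)"
      using that True by (intro zeta_side_reflect) auto
    hence "of_real pi powr (- s / 2) * rGamma ((1 - s) / 2) * zeta_right s =
        of_real pi powr (- (1 - s) / 2) * rGamma (s / 2) * zeta_right (1 - s)"
      by (simp add: zeta_side_def)
    hence "of_real pi powr (s / 2) * Gamma ((1 - s) / 2) * (of_real pi powr (- s / 2) * rGamma ((1 - s) / 2) * zeta_right s) =
        of_real pi powr (s / 2) * Gamma ((1 - s) / 2) * (of_real pi powr (- (1 - s) / 2) * rGamma (s / 2) * zeta_right (1 - s))"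
      by (simp only:)
    hence "(of_real pi powr (s / 2) * of_real pi powr (- s / 2)) * (Gamma ((1 - s) / 2) * rGamma ((1 - s) / 2)) * zeta_right s =
        (of_real pi powr (s / 2) * of_real pi powr (- (1 - s) / 2)) * Gamma ((1 - s) / 2) * rGamma (s / 2) * zeta_right (1 - s)"
      by (simp only: mult_ac)
    also have "of_real pi powr (s / 2) * of_real pi powr (- s / 2) = (1 :: complex)"
      by (simp flip: powr_add)
    also have "of_real pi powr (s / 2) * of_real pi powr (- (1 - s) / 2) = of_real pi powr (s / 2 + - (1 - s) / 2)"
      by (rule powr_add[symmetric])
    also have "s / 2 + - (1 - s) / 2 = s - 1/2" by (simp add: field_simps)
    also have "Gamma ((1 - s) / 2) * rGamma ((1 - s) / 2) = 1"
      using nz by (simp add: Gamma_def rGamma_eq_zero_iff)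
    finally show ?thesis using True \<open>s \<noteq> 1\<close> by (simp add: f_def fe_factor_def)
  qed (use that in \<open>auto simp: f_def\<close>)
  have f_right: "f s = zeta_right s" if "Re s > -1" "s \<noteq> 1" for s
    using that by (simp add: f_def)
  have "f holomorphic_on ({s. Re s > -1} - {1}) \<union> {s. Re s < 0}"
  proof (rule holomorphic_on_Un)
    show "f holomorphic_on {s. Re s > -1} - {1}"
      using zeta_right_holomorphic by (rule holomorphic_transform) (simp add: f_right)
    have "(\<lambda>s. zeta_right (1 - s)) holomorphic_on {s. Re s < 0}"
      by (rule holomorphic_on_compose_gen[OF _ zeta_right_holomorphic, unfolded o_def])
         (auto intro!: holomorphic_intros)
    hence "(\<lambda>s. fe_factor s * zeta_right (1 - s)) holomorphic_on {s. Re s < 0}"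
      unfolding fe_factor_def
      by (intro holomorphic_intros) (auto elim!: nonpos_Ints_cases simp: complex_eq_iff)
    thus "f holomorphic_on {s. Re s < 0}"
      by (rule holomorphic_transform) (simp add: f_left)
  qed (auto intro!: open_Diff open_halfspace_Re_gt open_halfspace_Re_lt)
  also have "({s. Re s > -1} - {1}) \<union> {s. Re s < 0} = - {1::complex}" by auto
  finally have f: "f holomorphic_on - {1}" .
  have f_series: "f s = (\<Sum>n. 1 / (of_nat (Suc n)) powr s)" if "1 < Re s" for s
  proof -
    have "s \<noteq> 1" using that by auto
    thus ?thesis using sums_unique[OF zeta_right_sums[OF that]] that
      by (simp add: f_def powr_minus_divide)
  qed
  have f1: "f 1 = 0" by (simp add: f_def)
  have "riemann_zeta = f" unfolding riemann_zeta_def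
  proof (rule the_equality)
    fix g :: "complex \<Rightarrow> complex"
    assume "g holomorphic_on - {1} \<and> (\<forall>s. 1 < Re s \<longrightarrow> g s = (\<Sum>n. 1 / (of_nat (Suc n)) powr s)) \<and> g 1 = 0"
    thus "g = f" by (intro riemann_zeta_unique f f1 f_series) blast+
  qed (use f f_series f1 in blast)
  thus "riemann_zeta holomorphic_on - {1}" "\<And>s. Re s > -1 \<Longrightarrow> s \<noteq> 1 \<Longrightarrow> riemann_zeta s = zeta_right s"
    using f f_right by auto
qed

section \<open>The Riemann--Siegel theta function and the function Z\<close>

lemma open_Omega: "open Omega"
proof -
  have "closed {z::complex. Re z = 0 \<and> \<bar>Im z\<bar> \<ge> 1/2}"
    by (intro closed_Collect_conj closed_Collect_eq closed_Collect_le continuous_intros)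
  thus ?thesis by (simp add: Omega_def open_Compl)
qed

lemma connected_Omega: "connected Omega"
proof (rule starlike_imp_connected)
  show "starlike Omega" unfolding starlike_def
  proof (intro bexI[of _ 0] ballI subsetI)
    fix x y assume x: "x \<in> Omega" and "y \<in> closed_segment 0 x"
    then obtain u where u: "0 \<le> u" "u \<le> 1" "y = of_real u * x"
      by (auto simp: closed_segment_def scaleR_conv_of_real)
    show "y \<in> Omega"
    proof (cases "Re x = 0")
      case True
      have "\<bar>u * Im x\<bar> \<le> 1 * \<bar>Im x\<bar>" unfolding abs_mult using u by (intro mult_right_mono) auto
      thus ?thesis using u x True by (auto simp: Omega_def)
    next
      case False
      thus ?thesis using u x by (cases "u = 0") (auto simp: Omega_def)
    qed
  qed (auto simp: Omega_def)
qed

lemma strip_subset_Omega: "\<bar>Im z\<bar> < 1/2 \<Longrightarrow> z \<in> Omega"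
  by (auto simp: Omega_def)

lemma cnj_in_Omega: "z \<in> Omega \<Longrightarrow> cnj z \<in> Omega"
  by (auto simp: Omega_def)

lemma Gamma_args_Omega:
  assumes "t \<in> Omega"
  shows "1/4 + \<i> * t / 2 \<notin> \<real>\<^sub>\<le>\<^sub>0" "1/4 - \<i> * t / 2 \<notin> \<real>\<^sub>\<le>\<^sub>0"
  using assms by (auto simp: Omega_def complex_nonpos_Reals_iff)

text \<open>The predicate inside the definite description of \<open>RS_theta\<close>, named so that
  existence, uniqueness and conjugation symmetry can refer to it.\<close>

definition theta_spec :: "(complex \<Rightarrow> complex) \<Rightarrow> bool" where
  "theta_spec f \<longleftrightarrow> f holomorphic_on Omega \<and> f 0 = 0 \<and>
      (\<forall>t\<in>Omega. exp (2 * \<i> * f t) =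
          (complex_of_real pi) powr (- \<i> * t) * Gamma (1/4 + \<i> * t / 2) / Gamma (1/4 - \<i> * t / 2)) \<and>
      (\<forall>t. t \<notin> Omega \<longrightarrow> f t = 0)"

text \<open>2 i (f - g) is continuous on the connected set \<open>Omega\<close> with values in 2 pi
  i times the integers, hence constant, and it vanishes at 0.\<close>

lemma theta_spec_unique:
  assumes f: "theta_spec f" and g: "theta_spec g"
  shows "f = g"
proof
  fix t
  define h where "h = (\<lambda>t. 2 * \<i> * (f t - g t))"
  have nz: "Gamma (1/4 + \<i> * t / 2) \<noteq> 0" "Gamma (1/4 - \<i> * t / 2) \<noteq> 0" if "t \<in> Omega" for t
    using Gamma_args_Omega[OF that] nonpos_Ints_subset_nonpos_Reals Gamma_eq_zero_iff by blast+
  have exp_h: "exp (h t) = 1" if "t \<in> Omega" for t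
    using f g that nz[OF that] by (simp add: theta_spec_def h_def ring_distribs exp_diff)
  have "h constant_on Omega"
  proof (rule continuous_discrete_range_constant[OF connected_Omega])
    show "continuous_on Omega h" unfolding h_def
      using f g by (intro continuous_intros holomorphic_on_imp_continuous_on) (auto simp: theta_spec_def)
    fix x assume x: "x \<in> Omega"
    have "2 * pi \<le> norm (h y - h x)" if y: "y \<in> Omega" "h y \<noteq> h x" for y
    proof -
      have "exp (h y - h x) = 1" using exp_h[OF x] exp_h[OF y(1)] by (simp add: exp_diff)
      then obtain n :: int where n: "Re (h y - h x) = 0" "Im (h y - h x) = of_int (2 * n) * pi"
        unfolding exp_eq_1 by blast
      have "n \<noteq> 0" using n y by (auto simp: complex_eq_iff)
      hence "1 \<le> \<bar>real_of_int n\<bar>" by linarith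
      hence "2 * pi * 1 \<le> 2 * pi * \<bar>real_of_int n\<bar>" by (intro mult_left_mono) auto
      also have "\<dots> = \<bar>Im (h y - h x)\<bar>" using n by (simp add: abs_mult)
      also have "\<dots> \<le> norm (h y - h x)" by (rule abs_Im_le_cmod)
      finally show ?thesis by simp
    qed
    thus "\<exists>e>0. \<forall>y. y \<in> Omega \<and> h y \<noteq> h x \<longrightarrow> e \<le> norm (h y - h x)"
      by (intro exI[of _ "2 * pi"]) auto
  qed
  moreover have "0 \<in> Omega" by (simp add: Omega_def)
  moreover have "h 0 = 0" using f g by (simp add: h_def theta_spec_def)
  ultimately have "h t = 0" if "t \<in> Omega" using that by (metis constant_on_def)
  thus "f t = g t" using f g by (cases "t \<in> Omega") (auto simp: h_def theta_spec_def)
qed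

text \<open>On \<open>Omega\<close> both Gamma arguments avoid the nonpositive reals, where
  \<open>ln_Gamma\<close> is cut, so a logarithm of the prescribed quotient can be written down. It
  is 0 at 0 because the two arguments coincide there.\<close>

lemma theta_spec_exists: "\<exists>f. theta_spec f"
proof -
  define L where "L t = ln_Gamma (1/4 + \<i> * t / 2) - ln_Gamma (1/4 - \<i> * t / 2) - \<i> * t * of_real (ln pi)" for t
  define f where "f t = (if t \<in> Omega then L t / (2 * \<i>) else 0)" for t
  have "L holomorphic_on Omega"
  proof -
    have "(\<lambda>t. ln_Gamma (1/4 + \<i> * t / 2)) holomorphic_on Omega"
      by (rule holomorphic_on_compose_gen[OF _ holomorphic_ln_Gamma[of "- \<real>\<^sub>\<le>\<^sub>0"], unfolded o_def])
         (use Gamma_args_Omega in \<open>auto intro!: holomorphic_intros\<close>)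
    moreover have "(\<lambda>t. ln_Gamma (1/4 - \<i> * t / 2)) holomorphic_on Omega"
      by (rule holomorphic_on_compose_gen[OF _ holomorphic_ln_Gamma[of "- \<real>\<^sub>\<le>\<^sub>0"], unfolded o_def])
         (use Gamma_args_Omega in \<open>auto intro!: holomorphic_intros\<close>)
    ultimately show ?thesis unfolding L_def by (intro holomorphic_intros)
  qed
  hence "(\<lambda>t. L t / (2 * \<i>)) holomorphic_on Omega" by (intro holomorphic_intros) auto
  hence "f holomorphic_on Omega" by (rule holomorphic_transform) (simp add: f_def)
  moreover have "exp (2 * \<i> * f t) = (complex_of_real pi) powr (- \<i> * t) * Gamma (1/4 + \<i> * t / 2) / Gamma (1/4 - \<i> * t / 2)"
    if "t \<in> Omega" for t
  proof -
    have "1/4 + \<i> * t / 2 \<notin> \<int>\<^sub>\<le>\<^sub>0" "1/4 - \<i> * t / 2 \<notin> \<int>\<^sub>\<le>\<^sub>0"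
      using Gamma_args_Omega[OF that] nonpos_Ints_subset_nonpos_Reals by blast+
    hence G: "Gamma (1/4 + \<i> * t / 2) = exp (ln_Gamma (1/4 + \<i> * t / 2))"
      "Gamma (1/4 - \<i> * t / 2) = exp (ln_Gamma (1/4 - \<i> * t / 2))"
      by (simp_all add: Gamma_complex_altdef)
    have "exp (2 * \<i> * f t) = exp (L t)" using that by (simp add: f_def)
    also have "\<dots> = exp (- \<i> * t * of_real (ln pi)) * exp (ln_Gamma (1/4 + \<i> * t / 2)) / exp (ln_Gamma (1/4 - \<i> * t / 2))"
      unfolding L_def by (simp add: exp_diff exp_add exp_minus field_simps)
    also have "exp (- \<i> * t * of_real (ln pi)) = (complex_of_real pi) powr (- \<i> * t)"
      by (simp add: powr_def Ln_of_real)
    finally show ?thesis by (simp only: G)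
  qed
  moreover have "f 0 = 0" by (simp add: f_def L_def)
  ultimately have "theta_spec f" by (auto simp: theta_spec_def f_def)
  thus ?thesis by blast
qed

lemma theta_spec_RS_theta: "theta_spec RS_theta"
proof -
  have "RS_theta = (THE f. theta_spec f)" unfolding RS_theta_def theta_spec_def ..
  thus ?thesis using theta_spec_exists theta_spec_unique by (metis theI')
qed

text \<open>The conjugated function satisfies \<open>theta_spec\<close> too: conjugation and the
  passage from t to its conjugate swap the two Gamma factors, and this inversion is undone by the
  conjugate of i in the exponent.\<close>

lemma cnj_RS_theta: "cnj (RS_theta (cnj t)) = RS_theta t"
proof -
  have sp: "RS_theta holomorphic_on Omega" "RS_theta 0 = 0"
    "\<And>t. t \<in> Omega \<Longrightarrow> exp (2 * \<i> * RS_theta t) =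
          (complex_of_real pi) powr (- \<i> * t) * Gamma (1/4 + \<i> * t / 2) / Gamma (1/4 - \<i> * t / 2)"
    "\<And>t. t \<notin> Omega \<Longrightarrow> RS_theta t = 0"
    using theta_spec_RS_theta by (auto simp: theta_spec_def)
  have im: "cnj ` Omega = Omega"
    using cnj_in_Omega by (auto simp: image_iff) (metis complex_cnj_cnj)
  have "theta_spec (cnj \<circ> RS_theta \<circ> cnj)" unfolding theta_spec_def
  proof (intro conjI ballI allI impI)
    show "cnj \<circ> RS_theta \<circ> cnj holomorphic_on Omega"
      using sp(1) open_Omega by (intro holomorphic_on_compose_cnj_cnj) (simp_all add: im)
    show "(cnj \<circ> RS_theta \<circ> cnj) 0 = 0" using sp(2) by simp
    show "(cnj \<circ> RS_theta \<circ> cnj) t = 0" if "t \<notin> Omega" for t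
      using sp(4)[of "cnj t"] cnj_in_Omega[of "cnj t"] that by auto
    fix t assume t: "t \<in> Omega"
    have "exp (2 * \<i> * (cnj \<circ> RS_theta \<circ> cnj) t) = inverse (cnj (exp (2 * \<i> * RS_theta (cnj t))))"
      by (simp add: exp_cnj flip: exp_minus)
    also have "\<dots> = inverse (of_real pi powr (\<i> * t) * Gamma (1/4 - \<i> * t / 2) / Gamma (1/4 + \<i> * t / 2))"
      using sp(3)[OF cnj_in_Omega[OF t]] by (simp add: cnj_Gamma cnj_powr)
    also have "\<dots> = of_real pi powr (- \<i> * t) * Gamma (1/4 + \<i> * t / 2) / Gamma (1/4 - \<i> * t / 2)"
      by (simp add: powr_minus field_simps)
    finally show "exp (2 * \<i> * (cnj \<circ> RS_theta \<circ> cnj) t) =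
       of_real pi powr (- \<i> * t) * Gamma (1/4 + \<i> * t / 2) / Gamma (1/4 - \<i> * t / 2)" .
  qed
  from theta_spec_unique[OF this theta_spec_RS_theta] show ?thesis by (metis comp_apply)
qed

lemma cnj_zeta_right:
  assumes "Re s > -1" "s \<noteq> 1"
  shows "cnj (zeta_right s) = zeta_right (cnj s)"
proof -
  have 1: "cnj (zeta_trapezoid s n) = zeta_trapezoid (cnj s) n" for n
    by (simp add: zeta_trapezoid_def cnj_powr del: of_nat_Suc)
  have "cnj s \<noteq> 1" using assms by (metis complex_cnj_cnj complex_cnj_one)
  have "(\<lambda>n. cnj (zeta_trapezoid s (Suc n))) sums cnj (\<Sum>n. zeta_trapezoid s (Suc n))"
    unfolding sums_cnj by (intro summable_sums summable_zeta_trapezoid assms)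
  hence "cnj (\<Sum>n. zeta_trapezoid s (Suc n)) = (\<Sum>n. zeta_trapezoid (cnj s) (Suc n))"
    unfolding 1 by (simp add: sums_iff)
  thus ?thesis by (simp add: zeta_right_def)
qed

section \<open>Z on complex arguments: holomorphy, symmetry and growth\<close>

definition hardy_Z :: "complex \<Rightarrow> complex" where
  "hardy_Z z = exp (\<i> * RS_theta z) * riemann_zeta (1/2 + \<i> * z)"

lemma hardy_Z_holomorphic: "hardy_Z holomorphic_on Omega"
proof -
  have "(\<lambda>z. riemann_zeta (1/2 + \<i> * z)) holomorphic_on Omega"
  proof (rule holomorphic_on_compose_gen[OF _ riemann_zeta_holomorphic, unfolded o_def])
    \<comment> \<open>The pole of zeta corresponds to z = -i/2, the endpoint of the lower
      cut.\<close>
    show "(\<lambda>z. 1/2 + \<i> * z) ` Omega \<subseteq> - {1}"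
    proof safe
      fix z assume "z \<in> Omega" "1/2 + \<i> * z = 1"
      thus False by (auto simp: Omega_def complex_eq_iff)
    qed
  qed (auto intro!: holomorphic_intros)
  thus ?thesis unfolding hardy_Z_def using theta_spec_RS_theta
    by (intro holomorphic_intros) (auto simp: theta_spec_def)
qed

text \<open>The factor in the functional equation relating s = 1/2 + i z to 1 - s is exactly exp(-2
  i theta(z)), by the defining equation of theta. Half of the exponent is absorbed on each
  side.\<close>

lemma hardy_Z_reflect:
  assumes "\<bar>Im z\<bar> < 1/2"
  shows "hardy_Z z = exp (- \<i> * RS_theta z) * riemann_zeta (1/2 - \<i> * z)"
proof -
  have z: "z \<in> Omega" using assms by (rule strip_subset_Omega)
  define A where "A = rGamma (1/4 + \<i> * z / 2)"
  define B where "B = rGamma (1/4 - \<i> * z / 2)"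
  have B: "B \<noteq> 0"
    using Gamma_args_Omega[OF z] nonpos_Ints_subset_nonpos_Reals by (auto simp: B_def rGamma_eq_zero_iff)
  have s: "1/2 + \<i> * z \<noteq> 1" "1/2 - \<i> * z \<noteq> 1" "1/2 + \<i> * z \<noteq> 0" using assms by (auto simp: complex_eq_iff)
  have arg: "(1 - (1/2 + \<i> * z)) / 2 = 1/4 - \<i> * z / 2" "(1 - (1/2 - \<i> * z)) / 2 = 1/4 + \<i> * z / 2"
    by (simp_all add: field_simps)
  have pw: "- (1/2 + \<i> * z) / 2 = - 1/4 - \<i> * z / 2" "- (1/2 - \<i> * z) / 2 = - 1/4 - \<i> * z / 2 + \<i> * z"
    by (simp_all add: field_simps)
  have "zeta_side (1/2 + \<i> * z) = zeta_side (1 - (1/2 + \<i> * z))"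
    using s assms by (intro zeta_side_reflect) auto
  also have "1 - (1/2 + \<i> * z) = 1/2 - \<i> * z" by simp
  finally have "of_real pi powr (- 1/4 - \<i> * z / 2) * (B * zeta_right (1/2 + \<i> * z)) =
     of_real pi powr (- 1/4 - \<i> * z / 2) * (of_real pi powr (\<i> * z) * A * zeta_right (1/2 - \<i> * z))"
    unfolding zeta_side_def arg pw powr_add by (simp add: A_def B_def mult_ac)
  hence "B * zeta_right (1/2 + \<i> * z) = of_real pi powr (\<i> * z) * A * zeta_right (1/2 - \<i> * z)"
    by (subst (asm) mult_cancel_left) simp
  hence "zeta_right (1/2 + \<i> * z) = of_real pi powr (\<i> * z) * A * zeta_right (1/2 - \<i> * z) / B"
    using B by (simp add: field_simps)
  also have "\<dots> = inverse (exp (2 * \<i> * RS_theta z)) * zeta_right (1/2 - \<i> * z)"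
    using theta_spec_RS_theta z
    by (simp add: theta_spec_def Gamma_def A_def B_def powr_minus field_simps)
  finally have "riemann_zeta (1/2 + \<i> * z) = exp (- (2 * \<i> * RS_theta z)) * riemann_zeta (1/2 - \<i> * z)"
    using s assms by (simp add: riemann_zeta_eq_zeta_right exp_minus)
  thus ?thesis unfolding hardy_Z_def by (simp flip: mult.assoc exp_add)
qed

text \<open>Conjugation turns the left side into the right side of \<open>hardy_Z_reflect\<close>,
  since zeta and theta both commute with conjugation.\<close>

lemma cnj_hardy_Z:
  assumes "\<bar>Im z\<bar> < 1/2"
  shows "cnj (hardy_Z (cnj z)) = hardy_Z z"
proof -
  have s: "1/2 + \<i> * cnj z \<noteq> 1" "1/2 - \<i> * z \<noteq> 1" using assms by (auto simp: complex_eq_iff)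
  have "cnj (riemann_zeta (1/2 + \<i> * cnj z)) = riemann_zeta (1/2 - \<i> * z)"
    using s assms cnj_zeta_right[of "1/2 + \<i> * cnj z"] by (simp add: riemann_zeta_eq_zeta_right)
  thus ?thesis unfolding hardy_Z_reflect[OF assms] by (simp add: hardy_Z_def exp_cnj cnj_RS_theta)
qed

lemma hardy_Z_bound:
  assumes "0 < \<sigma>" "\<sigma> < 1/2"
  obtains B where "B > 0" "\<And>z. \<bar>Im z\<bar> \<le> \<sigma> \<Longrightarrow> norm (hardy_Z z) \<le> B * (1 + norm z)\<^sup>2"
proof
  define K where "K = (\<Sum>n. real (Suc n) powr - 2)"
  have K: "K \<ge> 0" unfolding K_def using summable_Suc_powr[of 0] by (intro suminf_nonneg) auto
  \<comment> \<open>The summands bound the three parts of \<open>zeta_right\<close>: the constant,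
    the pole term with |s - 1| at least 1/2 - \<sigma>, and the series, where 2 comes from |s + 1|
    <= 2 (1 + |z|).\<close>
  define B where "B = 1/2 + 1 / (1/2 - \<sigma>) + 2 * K"
  show "B > 0" using assms K by (auto simp: B_def intro!: add_pos_nonneg)
  fix z :: complex assume z: "\<bar>Im z\<bar> \<le> \<sigma>"
  have zeta: "norm (riemann_zeta s) \<le> B * (1 + norm z)\<^sup>2" if s: "s = 1/2 + \<i> * z \<or> s = 1/2 - \<i> * z" for s
  proof -
    have re: "Re s \<ge> 0" "\<bar>Re (s - 1)\<bar> \<ge> 1/2 - \<sigma>" using s z assms by auto
    have s1: "norm (s - 1) \<ge> 1/2 - \<sigma>" using re(2) abs_Re_le_cmod[of "s - 1"] by linarith
    hence "s \<noteq> 1" using assms by auto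
    have ns: "norm s \<le> 1 + norm z"
      using s norm_triangle_ineq[of "1/2" "\<i> * z"] norm_triangle_ineq4[of "1/2" "\<i> * z"] by (auto simp: norm_mult)
    have ns': "norm (s + 1) \<le> 2 * (1 + norm z)"
    proof -
      have "norm (s + 1) \<le> norm s + 1" using norm_triangle_ineq[of s 1] by simp
      also have "\<dots> \<le> (1 + norm z) + 1" using ns by (rule add_right_mono)
      also have "\<dots> \<le> 2 * (1 + norm z)" by simp
      finally show ?thesis .
    qed
    have sq: "1 \<le> (1 + norm z)\<^sup>2" by (simp add: one_le_power)
    have "norm (riemann_zeta s) = norm (zeta_right s)"
      using re \<open>s \<noteq> 1\<close> by (simp add: riemann_zeta_eq_zeta_right)
    also have "\<dots> \<le> 1/2 + 1 / norm (s - 1) + norm s * norm (s + 1) * K"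
      unfolding K_def using re \<open>s \<noteq> 1\<close> by (intro norm_zeta_right_le)
    also have "\<dots> \<le> (1/2 + 1 / (1/2 - \<sigma>)) * 1 + (1 + norm z) * (2 * (1 + norm z)) * K"
      using s1 assms ns ns' K
      by (auto intro!: add_mono mult_right_mono mult_mono divide_left_mono mult_pos_pos)
    also have "\<dots> \<le> (1/2 + 1 / (1/2 - \<sigma>)) * (1 + norm z)\<^sup>2 + (1 + norm z) * (2 * (1 + norm z)) * K"
      using assms by (intro add_mono mult_left_mono sq) auto
    also have "\<dots> = B * (1 + norm z)\<^sup>2" by (simp add: B_def power2_eq_square algebra_simps)
    finally show ?thesis .
  qed
  \<comment> \<open>Writing one factor in its original form and the other in reflected form cancels
    the exponentials of theta.\<close>
  have "(norm (hardy_Z z))\<^sup>2 = norm (hardy_Z z * hardy_Z z)" by (simp add: power2_eq_square norm_mult)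
  also have "hardy_Z z * hardy_Z z = (exp (\<i> * RS_theta z) * riemann_zeta (1/2 + \<i> * z)) *
     (exp (- \<i> * RS_theta z) * riemann_zeta (1/2 - \<i> * z))"
    using hardy_Z_reflect[of z] z assms by (simp add: hardy_Z_def)
  also have "\<dots> = riemann_zeta (1/2 + \<i> * z) * riemann_zeta (1/2 - \<i> * z)"
    by (simp add: exp_minus)
  also have "norm \<dots> \<le> (B * (1 + norm z)\<^sup>2) * (B * (1 + norm z)\<^sup>2)"
    unfolding norm_mult using \<open>B > 0\<close> by (intro mult_mono zeta) auto
  finally have "(norm (hardy_Z z))\<^sup>2 \<le> (B * (1 + norm z)\<^sup>2)\<^sup>2" by (simp add: power2_eq_square)
  thus "norm (hardy_Z z) \<le> B * (1 + norm z)\<^sup>2"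
    by (rule power2_le_imp_le) (use \<open>B > 0\<close> in auto)
qed

section \<open>Moving the line of integration\<close>

lemma norm_sinh_ge: "norm (sinh (w :: complex)) \<ge> \<bar>sinh (Re w)\<bar>"
proof -
  have "\<bar>norm (exp w) - norm (exp (- w))\<bar> \<le> norm (exp w - exp (- w))"
    by (rule norm_triangle_ineq3)
  thus ?thesis by (simp add: sinh_field_def norm_divide)
qed

text \<open>A fourth power outweighs the quadratic growth of \<open>hardy_Z\<close> and leaves
  integrable decay. It comes from exp(a) = exp(a/4)^4 and exp(a/4) >= 1 + a/4; the constant is 4 *
  4^4, one factor 4 being lost in sinh(a) >= exp(a)/4.\<close>

lemma sinh_ge_power4:
  fixes a u :: real
  assumes "1 \<le> u" "u \<le> a"
  shows "sinh a \<ge> (1 + u) ^ 4 / 1024"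
proof -
  have "exp a \<ge> 2" using exp_ge_add_one_self[of a] assms by linarith
  have "exp (- a) = 1 / exp a" by (simp add: exp_minus inverse_eq_divide)
  also have "\<dots> \<le> exp a / 4"
  proof -
    have "4 \<le> exp a * exp a" using mult_mono[OF \<open>exp a \<ge> 2\<close> \<open>exp a \<ge> 2\<close>] by simp
    thus ?thesis by (simp add: field_simps)
  qed
  finally have 1: "sinh a \<ge> exp a / 4" using \<open>exp a \<ge> 2\<close> by (simp add: sinh_field_def)
  have "(1 + u) / 4 \<le> 1 + a / 4" using assms by simp
  also have "\<dots> \<le> exp (a / 4)" by (rule exp_ge_add_one_self)
  finally have "(1 + u) / 4 \<le> exp (a / 4)" .
  hence "((1 + u) / 4) ^ 4 \<le> exp (a / 4) ^ 4" using assms by (intro power_mono) auto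
  also have "exp (a / 4) ^ 4 = exp a" by (simp flip: exp_of_nat_mult)
  finally show ?thesis using 1 by (simp add: power_divide)
qed

text \<open>The zeros are the points 2 i n with n an integer, and 0 is the only one with |Im x| <
  2.\<close>

lemma sinh_half_pi_eq_0_iff:
  assumes "\<bar>Im x\<bar> < 2"
  shows "sinh (of_real pi * x / 2) = 0 \<longleftrightarrow> x = 0"
proof
  assume "sinh (of_real pi * x / 2) = 0"
  hence "exp (of_real pi * x / 2) = exp (- (of_real pi * x / 2))" by (simp add: sinh_field_def)
  hence "exp (of_real pi * x / 2 - - (of_real pi * x / 2)) = 1" by (subst exp_diff) simp
  hence "exp (of_real pi * x) = 1" by (simp flip: mult_2)
  then obtain n :: int where n: "Re (of_real pi * x) = 0" "Im (of_real pi * x) = of_int (2 * n) * pi"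
    unfolding exp_eq_1 by blast
  hence "Re x = 0" "Im x = 2 * of_int n" by auto
  moreover from this assms have "n = 0" by auto
  ultimately show "x = 0" by (simp add: complex_eq_iff)
qed auto

lemma integrable_inverse_1_plus_square: "integrable lborel (\<lambda>x::real. inverse (1 + x\<^sup>2))"
proof -
  have nz: "1 + x\<^sup>2 \<noteq> 0" for x :: real by (metis add_pos_nonneg less_irrefl zero_le_power2 zero_less_one)
  have "set_integrable lborel (einterval (-\<infinity>) \<infinity>) (\<lambda>x. inverse (1 + x\<^sup>2))"
    by (rule interval_integral_FTC_nonneg[where F = arctan and A = "- (pi/2)" and B = "pi/2"])
       (use nz in \<open>auto intro!: derivative_eq_intros continuous_intros tendsto_arctan_at_top tendsto_arctan_at_bot
          simp: ereal_tendsto_simps\<close>)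
  thus ?thesis by (simp add: set_integrable_def einterval_def)
qed

lemma integrable_of_quadratic_decay:
  fixes f :: "real \<Rightarrow> complex"
  assumes cont: "continuous_on UNIV f" and decay: "\<And>u. \<bar>u\<bar> \<ge> 1 \<Longrightarrow> norm (f u) \<le> C / (1 + u\<^sup>2)"
  shows "integrable lborel f"
proof -
  have "compact (f ` {-1..1})"
    by (intro compact_continuous_image continuous_on_subset[OF cont]) auto
  then obtain M where "\<forall>z \<in> f ` {-1..1}. norm z \<le> M"
    by (meson bounded_iff compact_imp_bounded)
  hence M: "norm (f u) \<le> M" if "\<bar>u\<bar> \<le> 1" for u using that by (auto simp: abs_le_iff)
  \<comment> \<open>On [-1, 1] one has 1 + u^2 <= 2, so the bound M is at most 2 M / (1 +
    u^2).\<close>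
  define D where "D = max C (2 * M)"
  have "M \<ge> 0" using norm_ge_zero[of "f 0"] M[of 0] by linarith
  have dom: "integrable lborel (\<lambda>x::real. D * inverse (1 + x\<^sup>2))"
    by (intro integrable_mult_right integrable_inverse_1_plus_square)
  have meas: "f \<in> borel_measurable lborel"
    using borel_measurable_continuous_onI[OF cont] by simp
  have "norm (f u) \<le> norm (D * inverse (1 + u\<^sup>2))" for u
  proof -
    have pos: "1 + u\<^sup>2 > 0" by (simp add: add_pos_nonneg)
    have "norm (f u) \<le> D / (1 + u\<^sup>2)"
    proof (cases "\<bar>u\<bar> \<le> 1")
      case True
      hence "1 + u\<^sup>2 \<le> 2" using abs_square_le_1 by auto
      hence "M * (1 + u\<^sup>2) \<le> M * 2" using \<open>M \<ge> 0\<close> by (intro mult_left_mono)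
      hence "M \<le> D / (1 + u\<^sup>2)" using pos by (simp add: D_def field_simps)
      thus ?thesis using M[OF True] by linarith
    next
      case False
      hence "norm (f u) \<le> C / (1 + u\<^sup>2)" by (intro decay) auto
      also have "\<dots> \<le> D / (1 + u\<^sup>2)" using pos by (intro divide_right_mono) (auto simp: D_def)
      finally show ?thesis .
    qed
    also have "\<dots> \<le> norm (D * inverse (1 + u\<^sup>2))" by (simp add: divide_inverse)
    finally show ?thesis .
  qed
  thus ?thesis by (intro Bochner_Integration.integrable_bound[OF dom meas] AE_I2)
qed

text \<open>Dominated convergence connects the Henstock-Kurzweil integrals over bounded segments,
  which come from contours, with the Lebesgue integral in \<open>U_fun\<close>.\<close>

lemma integral_symmetric_interval_tendsto:
  fixes f :: "real \<Rightarrow> complex"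
  assumes "integrable lborel f"
  shows "(\<lambda>n. integral {- real n..real n} f) \<longlonglongrightarrow> (LINT x|lborel. f x)"
proof -
  have "(\<lambda>n. LINT x|lborel. indicator {- real n..real n} x *\<^sub>R f x) \<longlonglongrightarrow> (LINT x|lborel. f x)"
  proof (rule integral_dominated_convergence[where w = "\<lambda>x. norm (f x)"])
    show "AE x in lborel. (\<lambda>n. indicator {- real n..real n} x *\<^sub>R f x) \<longlonglongrightarrow> f x"
    proof (rule AE_I2, rule tendsto_eventually)
      fix x :: real
      obtain N where "\<bar>x\<bar> \<le> real N" using real_arch_simple by blast
      thus "\<forall>\<^sub>F n in sequentially. indicator {- real n..real n} x *\<^sub>R f x = f x"
        by (intro eventually_sequentiallyI[of N]) (auto simp: indicator_def)
    qed
  qed (use assms in \<open>auto simp: indicator_def\<close>)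
  moreover have "(LINT x|lborel. indicator {- real n..real n} x *\<^sub>R f x) = integral {- real n..real n} f" for n
    using set_borel_integral_eq_integral(2)[of "{- real n..real n}" f] integrable_mult_indicator[OF _ assms, of "{- real n..real n}"]
    by (simp add: set_lebesgue_integral_def set_integrable_def)
  ultimately show ?thesis by simp
qed

lemma contour_integral_linepath_horizontal:
  fixes F :: "complex \<Rightarrow> complex"
  assumes "a < b"
  shows "contour_integral (linepath (of_real a + c) (of_real b + c)) F = integral {a..b} (\<lambda>u. F (of_real u + c))"
proof -
  have "linepath (of_real a + c) (of_real b + c) x = linepath (of_real a) (of_real b) x + c" for x
    by (simp add: linepath_def algebra_simps scaleR_conv_of_real)
  hence "contour_integral (linepath (of_real a + c) (of_real b + c)) F =
     contour_integral (linepath (of_real a) (of_real b)) (\<lambda>z. F (z + c))"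
    by (simp add: contour_integral_integral)
  also have "\<dots> = integral {a..b} (\<lambda>u. F (of_real u + c))"
    using contour_integral_linepath_Reals_eq[of "of_real a" "of_real b" "\<lambda>z. F (z + c)"] assms by simp
  finally show ?thesis .
qed

section \<open>The contour integrand: pole, conjugation symmetry and decay\<close>

definition Z_kernel :: "real \<Rightarrow> complex \<Rightarrow> complex" where
  "Z_kernel t x = hardy_Z (of_real t + x) * (of_real pi / (2 * sinh (of_real pi * x / 2)))"

lemma Z_kernel_holomorphic: "Z_kernel t holomorphic_on {x. \<bar>Im x\<bar> < 1/2} - {0}"
proof -
  have "(\<lambda>x. hardy_Z (of_real t + x)) holomorphic_on {x. \<bar>Im x\<bar> < 1/2} - {0}"
    by (rule holomorphic_on_compose_gen[OF _ hardy_Z_holomorphic, unfolded o_def])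
       (auto intro!: holomorphic_intros strip_subset_Omega)
  moreover have "(\<lambda>x::complex. sinh (of_real pi * x / 2)) holomorphic_on {x. \<bar>Im x\<bar> < 1/2} - {0}"
    unfolding sinh_field_def by (intro holomorphic_intros) auto
  ultimately show ?thesis unfolding Z_kernel_def
    by (intro holomorphic_intros) (auto simp: sinh_half_pi_eq_0_iff)
qed

text \<open>sinh(pi x / 2) / x tends to pi/2 at 0, which the constant in the kernel cancels.\<close>

lemma Z_kernel_residue: "residue (Z_kernel t) 0 = hardy_Z (of_real t)"
proof (rule residue_simple')
  show "open {x::complex. \<bar>Im x\<bar> < 1/2}"
    by (intro open_Collect_less continuous_intros)
  show "Z_kernel t holomorphic_on {x. \<bar>Im x\<bar> < 1/2} - {0}" by (rule Z_kernel_holomorphic)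
  have "((\<lambda>x::complex. sinh (of_real pi * x / 2)) has_field_derivative of_real pi / 2) (at 0)"
    by (auto intro!: derivative_eq_intros)
  hence sinh_lim: "((\<lambda>x::complex. sinh (of_real pi * x / 2) / x) \<longlongrightarrow> of_real pi / 2) (at 0)"
    by (simp add: has_field_derivative_iff)
  have "isCont (\<lambda>x. hardy_Z (of_real t + x)) 0"
  proof -
    have "of_real t \<in> Omega" by (intro strip_subset_Omega) auto
    hence "isCont hardy_Z (of_real t)"
      using hardy_Z_holomorphic open_Omega by (metis continuous_on_interior holomorphic_on_imp_continuous_on interior_open)
    thus ?thesis using isCont_o2[of 0 "\<lambda>x. of_real t + x" hardy_Z] by simp
  qed
  hence Z_lim: "((\<lambda>x. hardy_Z (of_real t + x)) \<longlongrightarrow> hardy_Z (of_real t)) (at 0)"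
    by (simp add: isCont_def)
  have "((\<lambda>x. hardy_Z (of_real t + x) * (of_real pi / (2 * (sinh (of_real pi * x / 2) / x)))) \<longlongrightarrow>
      hardy_Z (of_real t) * (of_real pi / (2 * (of_real pi / 2)))) (at 0)"
    by (intro tendsto_mult[OF Z_lim tendsto_divide[OF tendsto_const tendsto_mult[OF tendsto_const sinh_lim]]]) auto
  thus "((\<lambda>x. Z_kernel t x * (x - 0)) \<longlongrightarrow> hardy_Z (of_real t)) (at 0)"
    by (simp add: Z_kernel_def mult.assoc)
qed auto

lemma cnj_Z_kernel:
  assumes "\<bar>Im x\<bar> < 1/2"
  shows "Z_kernel t (cnj x) = cnj (Z_kernel t x)"
proof -
  have "cnj (hardy_Z (of_real t + x)) = hardy_Z (of_real t + cnj x)"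
    using cnj_hardy_Z[of "of_real t + cnj x"] assms by simp
  moreover have "cnj (sinh (of_real pi * x / 2)) = sinh (of_real pi * cnj x / 2)"
    by (simp add: sinh_field_def exp_cnj)
  ultimately show ?thesis by (simp add: Z_kernel_def)
qed

lemma Z_kernel_decay:
  assumes "0 < \<sigma>" "\<sigma> < 1/2"
  obtains C where "C > 0" "\<And>x. \<bar>Im x\<bar> \<le> \<sigma> \<Longrightarrow> \<bar>Re x\<bar> \<ge> 1 \<Longrightarrow> norm (Z_kernel t x) \<le> C / (1 + (Re x)\<^sup>2)"
proof -
  obtain B where B: "B > 0" "\<And>z. \<bar>Im z\<bar> \<le> \<sigma> \<Longrightarrow> norm (hardy_Z z) \<le> B * (1 + norm z)\<^sup>2"
    using hardy_Z_bound[OF assms] by blast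
  \<comment> \<open>(2 + |t|)(1 + u) with u = |Re x| bounds 1 + |t + x|; 1024 comes from
    \<open>sinh_ge_power4\<close> and pi/2 from the kernel.\<close>
  define C where "C = B * (2 + \<bar>t\<bar>)\<^sup>2 * (1024 * pi / 2)"
  have "norm (Z_kernel t x) \<le> C / (1 + (Re x)\<^sup>2)" if x: "\<bar>Im x\<bar> \<le> \<sigma>" "\<bar>Re x\<bar> \<ge> 1" for x
  proof -
    define u where "u = \<bar>Re x\<bar>"
    have u: "u \<ge> 1" using x by (simp add: u_def)
    have "norm (of_real t + x) \<le> \<bar>t\<bar> + (u + \<bar>Im x\<bar>)"
      using norm_triangle_ineq[of "of_real t" x] cmod_le[of x] by (simp add: u_def)
    hence "1 + norm (of_real t + x) \<le> 2 + \<bar>t\<bar> + u" using x assms by linarith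
    also have "\<dots> \<le> (2 + \<bar>t\<bar>) * (1 + u)" using u by (simp add: algebra_simps)
    finally have "(1 + norm (of_real t + x))\<^sup>2 \<le> ((2 + \<bar>t\<bar>) * (1 + u))\<^sup>2"
      by (intro power_mono) auto
    hence "B * (1 + norm (of_real t + x))\<^sup>2 \<le> B * ((2 + \<bar>t\<bar>)\<^sup>2 * (1 + u)\<^sup>2)"
      using B by (simp add: power_mult_distrib)
    moreover have "norm (hardy_Z (of_real t + x)) \<le> B * (1 + norm (of_real t + x))\<^sup>2"
      using x by (intro B) auto
    ultimately have Z: "norm (hardy_Z (of_real t + x)) \<le> B * ((2 + \<bar>t\<bar>)\<^sup>2 * (1 + u)\<^sup>2)" by linarith
    \<comment> \<open>This is the hypothesis u <= a of \<open>sinh_ge_power4\<close> for a = pi u /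
      2.\<close>
    have "1 * u \<le> pi / 2 * u" using pi_ge_two u by (intro mult_right_mono) auto
    hence "sinh (pi / 2 * u) \<ge> (1 + u) ^ 4 / 1024" using u by (intro sinh_ge_power4) auto
    moreover have "\<bar>sinh (Re (of_real pi * x / 2))\<bar> = sinh (pi / 2 * u)"
    proof -
      have "\<bar>sinh y\<bar> = sinh \<bar>y\<bar>" for y :: real
        by (cases "y \<ge> 0") (auto simp: abs_if)
      moreover have "\<bar>Re (of_real pi * x / 2)\<bar> = pi / 2 * u" by (simp add: u_def abs_mult)
      ultimately show ?thesis by metis
    qed
    ultimately have S: "norm (sinh (of_real pi * x / 2)) \<ge> (1 + u) ^ 4 / 1024"
      using norm_sinh_ge[of "of_real pi * x / 2"] by linarith
    have "norm (Z_kernel t x) = norm (hardy_Z (of_real t + x)) * (pi / 2 / norm (sinh (of_real pi * x / 2)))"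
      by (simp add: Z_kernel_def norm_mult norm_divide)
    also have "\<dots> \<le> (B * ((2 + \<bar>t\<bar>)\<^sup>2 * (1 + u)\<^sup>2)) * (pi / 2 / ((1 + u) ^ 4 / 1024))"
      using Z S u B order.strict_trans2[OF _ S, of 0]
      by (intro mult_mono divide_left_mono) (auto intro!: mult_pos_pos)
    also have "\<dots> = C / (1 + u)\<^sup>2"
    proof -
      have "(1 + u) ^ 4 = (1 + u)\<^sup>2 * (1 + u)\<^sup>2" by (simp add: power2_eq_square power4_eq_xxxx mult.assoc)
      moreover have "(B * (T * p)) * (pi / 2 / ((p * p) / 1024)) = B * T * (1024 * pi / 2) / p" if "p \<noteq> 0" for T p
        using that by (simp add: field_simps)
      moreover have "(1 + u)\<^sup>2 \<noteq> 0" using u by simp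
      ultimately show ?thesis unfolding C_def by presburger
    qed
    also have "\<dots> \<le> C / (1 + u\<^sup>2)"
    proof (rule divide_left_mono)
      show "1 + u\<^sup>2 \<le> (1 + u)\<^sup>2" using u by (simp add: power2_eq_square algebra_simps)
    qed (use B u in \<open>auto simp: C_def intro!: mult_pos_pos add_pos_nonneg\<close>)
    finally show ?thesis by (simp add: u_def)
  qed
  moreover have "C > 0" using B by (simp add: C_def)
  ultimately show thesis using that by blast
qed

lemma Z_kernel_integrable:
  assumes "0 < \<sigma>" "\<sigma> < 1/2" "\<bar>y\<bar> = \<sigma>"
  shows "integrable lborel (\<lambda>u. Z_kernel t (of_real u + \<i> * of_real y))"
proof -
  obtain C where C: "C > 0" "\<And>x. \<bar>Im x\<bar> \<le> \<sigma> \<Longrightarrow> \<bar>Re x\<bar> \<ge> 1 \<Longrightarrow> norm (Z_kernel t x) \<le> C / (1 + (Re x)\<^sup>2)"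
    using Z_kernel_decay[OF assms(1,2)] by blast
  show ?thesis
  proof (rule integrable_of_quadratic_decay)
    show "continuous_on UNIV (\<lambda>u. Z_kernel t (of_real u + \<i> * of_real y))"
      by (rule continuous_on_compose2[OF holomorphic_on_imp_continuous_on[OF Z_kernel_holomorphic]])
         (use assms in \<open>auto intro!: continuous_intros simp: complex_eq_iff\<close>)
    show "norm (Z_kernel t (of_real u + \<i> * of_real y)) \<le> C / (1 + u\<^sup>2)" if "\<bar>u\<bar> \<ge> 1" for u
      using C(2)[of "of_real u + \<i> * of_real y"] that assms by simp
  qed
qed

text \<open>The residue theorem on a rectangle around 0. The discrepancy between the horizontal
  integrals and the residue consists of the two vertical sides, each of length 2 \<sigma>.\<close>

lemma Z_kernel_rectangle:
  assumes "0 < \<sigma>" "\<sigma> < 1/2" "R > 0"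
    and C: "C > 0" "\<And>x. \<bar>Im x\<bar> \<le> \<sigma> \<Longrightarrow> \<bar>Re x\<bar> = R \<Longrightarrow> norm (Z_kernel t x) \<le> C"
  shows "norm (integral {-R..R} (\<lambda>u. Z_kernel t (of_real u - \<i> * of_real \<sigma>)) -
     integral {-R..R} (\<lambda>u. Z_kernel t (of_real u + \<i> * of_real \<sigma>)) - 2 * of_real pi * \<i> * hardy_Z (of_real t))
     \<le> 4 * \<sigma> * C"
proof -
  define S where "S = {x::complex. \<bar>Im x\<bar> < 1/2}"
  \<comment> \<open>Corners in counterclockwise order from the lower left, so the winding number
    about 0 is 1.\<close>
  define a1 a2 a3 a4 where a: "a1 = of_real (-R) - \<i> * of_real \<sigma>" "a2 = of_real R - \<i> * of_real \<sigma>"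
    "a3 = of_real R + \<i> * of_real \<sigma>" "a4 = of_real (-R) + \<i> * of_real \<sigma>"
  let ?F = "Z_kernel t"
  have S: "S = {x. Im x < 1/2} \<inter> {x. Im x > - 1/2}" by (auto simp: S_def)
  have rp: "rectpath a1 a3 = linepath a1 a2 +++ linepath a2 a3 +++ linepath a3 a4 +++ linepath a4 a1"
    by (simp add: rectpath_def Let_def a complex_eq_iff Complex_eq)
  have img: "path_image (rectpath a1 a3) \<subseteq> S - {0}"
    using assms by (subst path_image_rectpath) (auto simp: a S_def complex_eq_iff)
  have cont: "continuous_on (S - {0}) ?F"
    unfolding S_def by (intro holomorphic_on_imp_continuous_on Z_kernel_holomorphic)
  have seg: "closed_segment a1 a2 \<subseteq> S - {0}" "closed_segment a2 a3 \<subseteq> S - {0}"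
    "closed_segment a3 a4 \<subseteq> S - {0}" "closed_segment a4 a1 \<subseteq> S - {0}"
    using img unfolding rp by (auto simp: path_image_join)
  have int: "?F contour_integrable_on linepath a1 a2" "?F contour_integrable_on linepath a2 a3"
    "?F contour_integrable_on linepath a3 a4" "?F contour_integrable_on linepath a4 a1"
    by (intro contour_integrable_continuous_linepath continuous_on_subset[OF cont] seg)+
  have "contour_integral (rectpath a1 a3) ?F = 2 * pi * \<i> * (\<Sum>p\<in>{0}. winding_number (rectpath a1 a3) p * residue ?F p)"
  proof (rule Residue_theorem)
    show "open S" unfolding S by (intro open_Int open_halfspace_Im_lt open_halfspace_Im_gt)
    have "convex S" unfolding S by (intro convex_Int convex_halfspace_Im_lt convex_halfspace_Im_gt)
    thus "connected S" by (rule convex_connected)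
    show "?F holomorphic_on S - {0}" unfolding S_def by (rule Z_kernel_holomorphic)
    show "\<forall>z. z \<notin> S \<longrightarrow> winding_number (rectpath a1 a3) z = 0"
      using img \<open>convex S\<close> by (intro allI impI winding_number_zero_outside[of _ S]) auto
  qed (use img in auto)
  also have "winding_number (rectpath a1 a3) 0 = 1"
    using assms by (intro winding_number_rectpath) (auto simp: a in_box_complex_iff)
  hence "2 * pi * \<i> * (\<Sum>p\<in>{0}. winding_number (rectpath a1 a3) p * residue ?F p) = 2 * pi * \<i> * hardy_Z (of_real t)"
    by (simp add: Z_kernel_residue)
  finally have *: "contour_integral (rectpath a1 a3) ?F = 2 * pi * \<i> * hardy_Z (of_real t)" .
  have sum: "contour_integral (rectpath a1 a3) ?F = contour_integral (linepath a1 a2) ?F + (contour_integral (linepath a2 a3) ?F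
     + (contour_integral (linepath a3 a4) ?F + contour_integral (linepath a4 a1) ?F))"
    unfolding rp using int by (simp add: contour_integrable_joinI)
  have bot: "contour_integral (linepath a1 a2) ?F = integral {-R..R} (\<lambda>u. ?F (of_real u - \<i> * of_real \<sigma>))"
    using contour_integral_linepath_horizontal[of "-R" R "- \<i> * of_real \<sigma>" ?F] assms by (simp add: a)
  have "contour_integral (linepath a3 a4) ?F = - contour_integral (linepath a4 a3) ?F"
    by (simp add: contour_integral_reverse_linepath continuous_on_subset[OF cont] seg)
  hence top: "contour_integral (linepath a3 a4) ?F = - integral {-R..R} (\<lambda>u. ?F (of_real u + \<i> * of_real \<sigma>))"
    using contour_integral_linepath_horizontal[of "-R" R "\<i> * of_real \<sigma>" ?F] assms by (simp add: a)
  have vert: "norm (contour_integral (linepath b c) ?F) \<le> C * norm (c - b)"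
    if "?F contour_integrable_on linepath b c" "Re b = Re c" "\<bar>Re b\<bar> = R" "\<bar>Im b\<bar> \<le> \<sigma>" "\<bar>Im c\<bar> \<le> \<sigma>" for b c
  proof (rule contour_integral_bound_linepath[OF that(1)])
    fix x assume "x \<in> closed_segment b c"
    hence "Re x = Re b" "Im x \<in> closed_segment (Im b) (Im c)"
      using that(2) by (auto simp: closed_segment_same_Re)
    moreover from this(2) have "\<bar>Im x\<bar> \<le> \<sigma>"
      using that(4,5) by (auto simp: closed_segment_eq_real_ivl split: if_splits)
    ultimately show "norm (?F x) \<le> C" using that by (intro C) auto
  qed (use C in auto)
  have v1: "norm (contour_integral (linepath a2 a3) ?F) \<le> C * (2 * \<sigma>)"
    using vert[OF int(2)] assms by (simp add: a norm_mult)
  have v2: "norm (contour_integral (linepath a4 a1) ?F) \<le> C * (2 * \<sigma>)"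
    using vert[OF int(4)] assms by (simp add: a norm_mult)
  have "integral {-R..R} (\<lambda>u. ?F (of_real u - \<i> * of_real \<sigma>)) - integral {-R..R} (\<lambda>u. ?F (of_real u + \<i> * of_real \<sigma>))
     - 2 * of_real pi * \<i> * hardy_Z (of_real t) = - (contour_integral (linepath a2 a3) ?F + contour_integral (linepath a4 a1) ?F)"
    using sum unfolding * bot top by (simp add: algebra_simps)
  also have "norm \<dots> \<le> norm (contour_integral (linepath a2 a3) ?F) + norm (contour_integral (linepath a4 a1) ?F)"
    unfolding norm_minus_cancel by (rule norm_triangle_ineq)
  also have "\<dots> \<le> C * (2 * \<sigma>) + C * (2 * \<sigma>)" by (intro add_mono v1 v2)
  also have "\<dots> = 4 * \<sigma> * C" by simp
  finally show ?thesis .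
qed

text \<open>Let the rectangles widen: the decay of the kernel makes the vertical sides
  vanish.\<close>

lemma Z_kernel_line_integrals:
  assumes "0 < \<sigma>" "\<sigma> < 1/2"
  shows "(LINT u|lborel. Z_kernel t (of_real u - \<i> * of_real \<sigma>)) - (LINT u|lborel. Z_kernel t (of_real u + \<i> * of_real \<sigma>))
    = 2 * of_real pi * \<i> * hardy_Z (of_real t)"
proof -
  obtain C where C: "C > 0" "\<And>x. \<bar>Im x\<bar> \<le> \<sigma> \<Longrightarrow> \<bar>Re x\<bar> \<ge> 1 \<Longrightarrow> norm (Z_kernel t x) \<le> C / (1 + (Re x)\<^sup>2)"
    using Z_kernel_decay[OF assms] by blast
  define D where "D n = integral {- real n..real n} (\<lambda>u. Z_kernel t (of_real u - \<i> * of_real \<sigma>)) -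
     integral {- real n..real n} (\<lambda>u. Z_kernel t (of_real u + \<i> * of_real \<sigma>)) - 2 * of_real pi * \<i> * hardy_Z (of_real t)" for n
  have "D \<longlonglongrightarrow> (LINT u|lborel. Z_kernel t (of_real u - \<i> * of_real \<sigma>)) -
      (LINT u|lborel. Z_kernel t (of_real u + \<i> * of_real \<sigma>)) - 2 * of_real pi * \<i> * hardy_Z (of_real t)"
    unfolding D_def
    using Z_kernel_integrable[OF assms, of "- \<sigma>" t] Z_kernel_integrable[OF assms, of \<sigma> t] assms
    by (intro tendsto_intros integral_symmetric_interval_tendsto) auto
  moreover have "D \<longlonglongrightarrow> 0"
  proof (rule Lim_null_comparison)
    show "\<forall>\<^sub>F n in sequentially. norm (D n) \<le> 4 * \<sigma> * (C / (1 + (real n)\<^sup>2))"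
    proof (intro eventually_sequentiallyI[of 1])
      fix n :: nat assume n: "1 \<le> n"
      show "norm (D n) \<le> 4 * \<sigma> * (C / (1 + (real n)\<^sup>2))" unfolding D_def
      proof (rule Z_kernel_rectangle[OF assms])
        show "norm (Z_kernel t x) \<le> C / (1 + (real n)\<^sup>2)" if "\<bar>Im x\<bar> \<le> \<sigma>" "\<bar>Re x\<bar> = real n" for x
          using C(2)[OF that(1)] that(2) n by (metis of_nat_1 of_nat_le_iff power2_abs)
      qed (use n C in \<open>auto intro!: divide_pos_pos add_pos_nonneg\<close>)
    qed
    have "(\<lambda>n. 4 * \<sigma> * (C * (1 / (1 + (real n)\<^sup>2)))) \<longlonglongrightarrow> 4 * \<sigma> * (C * 0)"
      by (intro tendsto_intros) real_asymp
    thus "(\<lambda>n. 4 * \<sigma> * (C / (1 + (real n)\<^sup>2))) \<longlonglongrightarrow> 0" by simp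
  qed
  ultimately show ?thesis using LIMSEQ_unique by force
qed

theorem mainTheorem1:
  fixes t \<sigma> :: real
  assumes "0 < \<sigma>" and "\<sigma> < 1/2"
  shows "Z_fun t = complex_of_real (2 * Re (exp (\<i> * RS_theta (of_real t)) * U_fun \<sigma> t))"
proof -
  define I where "I = (LINT u|lborel. Z_kernel t (of_real u - \<i> * of_real \<sigma>))"
  define W where "W = I / (2 * of_real pi * \<i>)"
  \<comment> \<open>Moving the factor under the integral cancels exp(-i theta(t)) and leaves
    \<open>Z_kernel\<close>.\<close>
  have "exp (\<i> * RS_theta (of_real t)) * U_fun \<sigma> t = 1 / (2 * of_real pi * \<i>) *
     (LINT u|lborel. exp (\<i> * RS_theta (of_real t)) * (let x = complex_of_real u - \<i> * of_real \<sigma> in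
        exp (\<i> * RS_theta (of_real t + x) - \<i> * RS_theta (of_real t)) *
        riemann_zeta (1/2 + \<i> * (of_real t + x)) *
        (of_real pi / (2 * sinh (of_real pi * x / 2)))))"
    unfolding U_fun_def by (subst integral_mult_right_zero) (rule mult.left_commute)
  also have "(\<lambda>u. exp (\<i> * RS_theta (of_real t)) * (let x = complex_of_real u - \<i> * of_real \<sigma> in
        exp (\<i> * RS_theta (of_real t + x) - \<i> * RS_theta (of_real t)) *
        riemann_zeta (1/2 + \<i> * (of_real t + x)) *
        (of_real pi / (2 * sinh (of_real pi * x / 2))))) = (\<lambda>u. Z_kernel t (of_real u - \<i> * of_real \<sigma>))"
    by (simp add: fun_eq_iff Z_kernel_def hardy_Z_def Let_def exp_diff)
  finally have U: "exp (\<i> * RS_theta (of_real t)) * U_fun \<sigma> t = W" by (simp add: I_def W_def)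
  have "(\<lambda>u. Z_kernel t (of_real u + \<i> * of_real \<sigma>)) = (\<lambda>u. cnj (Z_kernel t (of_real u - \<i> * of_real \<sigma>)))"
  proof
    fix u
    show "Z_kernel t (of_real u + \<i> * of_real \<sigma>) = cnj (Z_kernel t (of_real u - \<i> * of_real \<sigma>))"
      using cnj_Z_kernel[of "of_real u - \<i> * of_real \<sigma>" t] assms by simp
  qed
  hence "I - cnj I = 2 * of_real pi * \<i> * hardy_Z (of_real t)"
    using Z_kernel_line_integrals[OF assms, of t] by (simp add: I_def)
  hence "hardy_Z (of_real t) = (I - cnj I) / (2 * of_real pi * \<i>)" by simp
  \<comment> \<open>The denominator 2 pi i is purely imaginary, so conjugating \<open>W\<close>
    changes its sign and the difference of integrals becomes a sum.\<close>
  also have "\<dots> = W + cnj W" by (simp add: W_def diff_divide_distrib)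
  also have "\<dots> = of_real (2 * Re W)" by (rule complex_add_cnj)
  finally show ?thesis by (simp add: U Z_fun_def hardy_Z_def)
qed

end
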